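(* Let $d\in\mathbb{N}$, $p\ge 1$, and let $\boldsymbol{\mu}=\{\mu_t\}_{t\in\mathbb{R}}$ be an absolutely continuous curve in the Wasserstein space $(\mathcal{P}_p(\mathbb{R}^d),W_p)$ whose metric derivative $|\boldsymbol{\mu}'|_t=\lim_{h\to 0}W_p(\mu_{t+h},\mu_t)/|h|$ satisfies $\Gamma:=\sup_{t\in\mathbb{R}}|\boldsymbol{\mu}'|_t<\infty$. Let $J\in\mathbb{N}$ and let $\boldsymbol{\mu}^{(J)}$ be the sequence sampled from $\boldsymbol{\mu}$ over the dyadic grid $2^{-J}\mathbb{Z}$, that is, $\mu^{(J)}_i=\mu_{2^{-J}i}$ for $i\in\mathbb{Z}$. Assume that we are either in the absolutely continuous setting or in the discrete setting described in the context. Let $\boldsymbol{\psi}^{(1)},\dots,\boldsymbol{\psi}^{(J)}$ be the detail coefficients of $\boldsymbol{\mu}^{(J)}$ generated by the elementary multiscale transform, $\boldsymbol{\mu}^{(\ell-1)}=\mathcal{D}\boldsymbol{\mu}^{(\ell)}$ and $\boldsymbol{\psi}^{(\ell)}=\boldsymbol{\mu}^{(\ell)}\ominus\mathcal{S}\boldsymbol{\mu}^{(\ell-1)}$ for $\ell=1,\dots,J$. Then $$\|\boldsymbol{\psi}^{(\ell)}\|_\infty\le \Gamma\,2^{1-\ell},\qquad \ell=1,\dots,J.$$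
   Context: Wasserstein space. $\mathcal{P}_p(\mathbb{R}^d)$ is the set of Borel probability measures $\mu$ on $\mathbb{R}^d$ with $\int\|x\|^p\,d\mu(x)<\infty$, with the metric $W_p^p(\mu,\nu)=\min_{\gamma\in\Pi(\mu,\nu)}\int\|x-y\|^p\,d\gamma(x,y)$, where $\Pi(\mu,\nu)$ is the set of couplings of $\mu$ and $\nu$. A curve $\{\mu_t\}_{t\in\mathbb{R}}$ is absolutely continuous if there is $g\in L^1_{\mathrm{loc}}(\mathbb{R})$ with $W_p(\mu_s,\mu_t)\le\int_s^t g(r)\,dr$ for all $s\le t$. Its metric derivative then exists for Lebesgue-almost every $t$, and the supremum defining $\Gamma$ is over those $t$ at which it exists. McCann average. For $\mu,\nu\in\mathcal{P}_p(\mathbb{R}^d)$ and an optimal plan $\gamma\in\Pi(\mu,\nu)$, $\mathfrak{M}(\mu,\nu;t)=(\pi^t)_\#\gamma$ with $\pi^t(x,y)=(1-t)x+ty$, $t\in[0,1]$. When the optimal plan is not unique, a choice is fixed once and for all for each pair. Absolutely continuous setting. All measures involved (the sequence elements and the predicted measures $(\mathcal{S}\boldsymbol{\mu}^{(\ell-1)})_i$) are absolutely continuous with respect to Lebesgue measure. $T_\mu^\nu$ denotes the Monge map, i.e. the optimal transport map from $\mu$ to $\nu$ for the cost $\|x-y\|^p$ (unique $\mu$-a.e. if $p>1$; if $p=1$ a Monge map is chosen consistently, with $T_\mu^\mu=I$). One has $\mathfrak{M}(\mu,\nu;t)=(I+t(T_\mu^\nu-I))_\#\mu$. The difference is the map $\nu\ominus\mu=T_\mu^\nu-I$,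 with $I$ the identity, and its size is $\|\nu\ominus\mu\|_{L^p(\mu)}=\left(\int\|T_\mu^\nu(x)-x\|^p\,d\mu(x)\right)^{1/p}$. Discrete setting. All measures in the sequence are finitely supported. For $\mu=\sum_{i=1}^m p_i^\mu\delta_{x_i^\mu}$ and $\nu=\sum_{j=1}^n p_j^\nu\delta_{x_j^\nu}$ with optimal coupling matrix $\Lambda_\mu^\nu=[\lambda_{i,j}]$ for the cost $\|x-y\|^p$, $\mathfrak{M}(\mu,\nu;t)=\sum_{i,j}\lambda_{i,j}\delta_{(1-t)x_i^\mu+tx_j^\nu}$. The difference is the pair $\nu\ominus\mu=([x_j^\nu-x_i^\mu]_{i,j},\Lambda_\mu^\nu)$, and its size is $\left(\sum_{i,j}\|x_j^\nu-x_i^\mu\|^p\lambda_{i,j}\right)^{1/p}$, used in place of $\|\nu\ominus\mu\|_{L^p(\mu)}$. Multiscale transform. Sequences are indexed by $\mathbb{Z}$, the $i$-th entry at level $\ell$ being associated with the grid point $2^{-\ell}i$. The elementary subdivision scheme is $(\mathcal{S}\boldsymbol{\mu})_{2i}=\mu_i$, $(\mathcal{S}\boldsymbol{\mu})_{2i+1}=\mathfrak{M}(\mu_i,\mu_{i+1};1/2)$. The downsampling operator is $(\mathcal{D}\boldsymbol{\mu})_i=\mu_{2i}$. The operation $\ominus$ is applied elementwise, so $\psi^{(\ell)}_i=\mu^{(\ell)}_i\ominus(\mathcal{S}\boldsymbol{\mu}^{(\ell-1)})_i$. Finally $\|\boldsymbol{\psi}^{(\ell)}\|_\infty=\sup_{i\in\mathbb{Z}}\|\psi_i^{(\ell)}\|$,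 where, writing $\mu=(\mathcal{S}\boldsymbol{\mu}^{(\ell-1)})_i$ for the base measure and $\nu=\mu^{(\ell)}_i$, so that $\psi^{(\ell)}_i=\nu\ominus\mu$, the size $\|\psi_i^{(\ell)}\|$ equals $\left(\int\|T_\mu^\nu(x)-x\|^p\,d\mu(x)\right)^{1/p}$ in the absolutely continuous setting and $\left(\sum_{k,j}\|x_j^\nu-x_k^\mu\|^p\lambda_{k,j}\right)^{1/p}$, with $[\lambda_{k,j}]=\Lambda_\mu^\nu$, in the discrete setting. *)

theory Defs
  imports "HOL-Probability.Probability"
begin

section \<open>Wasserstein space\<close>

definition wasserstein_space :: "real \<Rightarrow> 'a::euclidean_space measure set" where
  "wasserstein_space p =
     {\<mu>. prob_space \<mu> \<and> sets \<mu> = sets borel \<and> integrable \<mu> (\<lambda>x. norm x powr p)}"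

definition couplings ::
  "'a::euclidean_space measure \<Rightarrow> 'a measure \<Rightarrow> ('a \<times> 'a) measure set" where
  "couplings \<mu> \<nu> =
     {\<gamma>. prob_space \<gamma> \<and> sets \<gamma> = sets borel \<and>
         distr \<gamma> borel fst = \<mu> \<and> distr \<gamma> borel snd = \<nu>}"

definition transport_cost :: "real \<Rightarrow> ('a::euclidean_space \<times> 'a) measure \<Rightarrow> real" where
  "transport_cost p \<gamma> = (\<integral>z. norm (fst z - snd z) powr p \<partial>\<gamma>)"

text \<open>The Bochner integral returns \<open>0\<close> for a non-integrable function. On the Wasserstein space
  this default value never occurs.\<close>

lemma transport_cost_integrable:
  fixes \<mu> \<nu> :: "'a::euclidean_space measure"
  assumes "1 \<le> p" "\<mu> \<in> wasserstein_space p" "\<nu> \<in> wasserstein_space p" "\<gamma> \<in> couplings \<mu> \<nu>"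
  shows "integrable \<gamma> (\<lambda>z. norm (fst z - snd z) powr p)"
proof -
  have sg: "sets \<gamma> = sets borel" and f: "distr \<gamma> borel fst = \<mu>" and s: "distr \<gamma> borel snd = \<nu>"
    using assms(4) by (auto simp: couplings_def)
  have m1: "fst \<in> measurable \<gamma> borel" and m2: "snd \<in> measurable \<gamma> borel"
    unfolding measurable_cong_sets[OF sg refl]
    by (intro borel_measurable_continuous_onI continuous_intros)+
  have i1: "integrable \<gamma> (\<lambda>z. norm (fst z) powr p)"
    using assms(2) integrable_distr[OF m1, of "\<lambda>x. norm x powr p"]
    by (simp add: wasserstein_space_def f)
  have i2: "integrable \<gamma> (\<lambda>z. norm (snd z) powr p)"
    using assms(3) integrable_distr[OF m2, of "\<lambda>x. norm x powr p"]
    by (simp add: wasserstein_space_def s)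
  have le: "norm (x - y) powr p \<le> 2 powr p * (norm x powr p + norm y powr p)" for x y :: 'a
  proof -
    have "norm (x - y) \<le> 2 * max (norm x) (norm y)"
      using norm_triangle_ineq4[of x y] by linarith
    then have "norm (x - y) powr p \<le> (2 * max (norm x) (norm y)) powr p"
      using assms(1) by (intro powr_mono2) auto
    also have "\<dots> = 2 powr p * max (norm x) (norm y) powr p"
      by (simp add: powr_mult)
    also have "\<dots> \<le> 2 powr p * (norm x powr p + norm y powr p)"
      by (intro mult_left_mono) (auto simp: max_def)
    finally show ?thesis .
  qed
  show ?thesis
  proof (rule Bochner_Integration.integrable_bound)
    show "integrable \<gamma> (\<lambda>z. 2 powr p * (norm (fst z) powr p + norm (snd z) powr p))"
      using i1 i2 by auto
    show "(\<lambda>z. norm (fst z - snd z) powr p) \<in> borel_measurable \<gamma>"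
      using m1 m2 by measurable
    show "AE z in \<gamma>. norm (norm (fst z - snd z) powr p)
        \<le> norm (2 powr p * (norm (fst z) powr p + norm (snd z) powr p))"
      using le by auto
  qed
qed

text \<open>The infimum is attained on the Wasserstein space. It is taken over a nonempty set (the product
  coupling) that is bounded below by \<open>0\<close>.\<close>

definition wasserstein :: "real \<Rightarrow> 'a::euclidean_space measure \<Rightarrow> 'a measure \<Rightarrow> real" where
  "wasserstein p \<mu> \<nu> = (INF \<gamma>\<in>couplings \<mu> \<nu>. transport_cost p \<gamma>) powr (1 / p)"

definition optimal_plan ::
  "real \<Rightarrow> 'a::euclidean_space measure \<Rightarrow> 'a measure \<Rightarrow> ('a \<times> 'a) measure \<Rightarrow> bool" where
  "optimal_plan p \<mu> \<nu> \<gamma> \<longleftrightarrow>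
     \<gamma> \<in> couplings \<mu> \<nu> \<and> (\<forall>\<gamma>'\<in>couplings \<mu> \<nu>. transport_cost p \<gamma> \<le> transport_cost p \<gamma>')"

text \<open>A choice of one optimal plan for each ordered pair of measures.\<close>

definition optimal_plan_choice ::
  "real \<Rightarrow> ('a::euclidean_space measure \<Rightarrow> 'a measure \<Rightarrow> ('a \<times> 'a) measure) \<Rightarrow> bool" where
  "optimal_plan_choice p G \<longleftrightarrow>
     (\<forall>\<mu>\<in>wasserstein_space p. \<forall>\<nu>\<in>wasserstein_space p. optimal_plan p \<mu> \<nu> (G \<mu> \<nu>))"

section \<open>Absolutely continuous curves\<close>

definition abs_cont_curve :: "real \<Rightarrow> (real \<Rightarrow> 'a::euclidean_space measure) \<Rightarrow> bool" where
  "abs_cont_curve p c \<longleftrightarrow>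
     (\<forall>t. c t \<in> wasserstein_space p) \<and>
     (\<exists>g :: real \<Rightarrow> real. (\<forall>K. compact K \<longrightarrow> set_integrable lebesgue K g) \<and>
        (\<forall>s t. s \<le> t \<longrightarrow> wasserstein p (c s) (c t) \<le> set_lebesgue_integral lebesgue {s..t} g))"

definition has_metric_derivative ::
  "real \<Rightarrow> (real \<Rightarrow> 'a::euclidean_space measure) \<Rightarrow> real \<Rightarrow> real \<Rightarrow> bool" where
  "has_metric_derivative p c t D \<longleftrightarrow>
     ((\<lambda>h. wasserstein p (c (t + h)) (c t) / \<bar>h\<bar>) \<longlongrightarrow> D) (at 0)"

text \<open>The values \<open>D\<close> are nonnegative, so nothing is truncated by the embedding into \<open>ennreal\<close>,
  which is used to make the supremum meaningful when it is infinite.\<close>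

definition max_speed :: "real \<Rightarrow> (real \<Rightarrow> 'a::euclidean_space measure) \<Rightarrow> ennreal" where
  "max_speed p c = (SUP D\<in>{D. \<exists>t. has_metric_derivative p c t D}. ennreal D)"

section \<open>McCann averages and the multiscale transform\<close>

definition mccann ::
  "('a::euclidean_space measure \<Rightarrow> 'a measure \<Rightarrow> ('a \<times> 'a) measure)
    \<Rightarrow> 'a measure \<Rightarrow> 'a measure \<Rightarrow> real \<Rightarrow> 'a measure" where
  "mccann G \<mu> \<nu> t = distr (G \<mu> \<nu>) borel (\<lambda>(x, y). (1 - t) *\<^sub>R x + t *\<^sub>R y)"

definition subdivide ::
  "('a::euclidean_space measure \<Rightarrow> 'a measure \<Rightarrow> ('a \<times> 'a) measure)
    \<Rightarrow> (int \<Rightarrow> 'a measure) \<Rightarrow> int \<Rightarrow> 'a measure" where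
  "subdivide G m i =
     (if even i then m (i div 2) else mccann G (m (i div 2)) (m (i div 2 + 1)) (1 / 2))"

definition downsample :: "(int \<Rightarrow> 'b) \<Rightarrow> int \<Rightarrow> 'b" where
  "downsample m i = m (2 * i)"

section \<open>Absolutely continuous setting\<close>

definition ac_measure :: "'a::euclidean_space measure \<Rightarrow> bool" where
  "ac_measure \<mu> \<longleftrightarrow> sets \<mu> = sets borel \<and> absolutely_continuous lborel \<mu>"

definition transport_map :: "'a::euclidean_space measure \<Rightarrow> 'a measure \<Rightarrow> ('a \<Rightarrow> 'a) \<Rightarrow> bool" where
  "transport_map \<mu> \<nu> T \<longleftrightarrow> T \<in> borel_measurable borel \<and> distr \<mu> borel T = \<nu>"

definition monge_map ::
  "real \<Rightarrow> 'a::euclidean_space measure \<Rightarrow> 'a measure \<Rightarrow> ('a \<Rightarrow> 'a) \<Rightarrow> bool" where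
  "monge_map p \<mu> \<nu> T \<longleftrightarrow> transport_map \<mu> \<nu> T \<and>
     (\<forall>T'. transport_map \<mu> \<nu> T' \<longrightarrow>
        (\<integral>x. norm (T x - x) powr p \<partial>\<mu>) \<le> (\<integral>x. norm (T' x - x) powr p \<partial>\<mu>))"

text \<open>A choice of Monge maps between absolutely continuous measures, compatible with the plans used
  for the McCann averages: the chosen plan is the one induced by the chosen map. The
  normalisation of maps from a measure to itself is stated for \<open>p = 1\<close>; for other \<open>p\<close> it follows
  from optimality, since the identity has cost \<open>0\<close>.\<close>

definition monge_map_choice ::
  "real \<Rightarrow> ('a::euclidean_space measure \<Rightarrow> 'a measure \<Rightarrow> ('a \<times> 'a) measure)
    \<Rightarrow> ('a measure \<Rightarrow> 'a measure \<Rightarrow> 'a \<Rightarrow> 'a) \<Rightarrow> bool" where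
  "monge_map_choice p G T \<longleftrightarrow>
     (\<forall>\<mu>\<in>wasserstein_space p. \<forall>\<nu>\<in>wasserstein_space p. ac_measure \<mu> \<longrightarrow> ac_measure \<nu> \<longrightarrow>
        monge_map p \<mu> \<nu> (T \<mu> \<nu>) \<and> G \<mu> \<nu> = distr \<mu> borel (\<lambda>x. (x, T \<mu> \<nu> x))) \<and>
     (p = 1 \<longrightarrow>
        (\<forall>\<mu>\<in>wasserstein_space p. ac_measure \<mu> \<longrightarrow> (AE x in \<mu>. T \<mu> \<mu> x = x)))"

lemma mccann_monge:
  assumes "\<mu> \<in> wasserstein_space p" "\<nu> \<in> wasserstein_space p" "ac_measure \<mu>" "ac_measure \<nu>"
    and "monge_map_choice p G T"
  shows "mccann G \<mu> \<nu> t = distr \<mu> borel (\<lambda>x. x + t *\<^sub>R (T \<mu> \<nu> x - x))"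
proof -
  have G: "G \<mu> \<nu> = distr \<mu> borel (\<lambda>x. (x, T \<mu> \<nu> x))"
    and T: "T \<mu> \<nu> \<in> borel_measurable borel" and s: "sets \<mu> = sets borel"
    using assms by (auto simp: monge_map_choice_def monge_map_def transport_map_def
      wasserstein_space_def)
  have T': "(\<lambda>x. (x, T \<mu> \<nu> x)) \<in> measurable \<mu> borel"
    using T unfolding measurable_cong_sets[OF s refl]
    by (intro borel_measurable_Pair) simp_all
  have L: "(\<lambda>(x, y). (1 - t) *\<^sub>R x + t *\<^sub>R y) \<in> borel_measurable (borel :: ('a \<times> 'a) measure)"
    unfolding split_beta by (intro borel_measurable_continuous_onI continuous_intros)
  show ?thesis
    unfolding mccann_def G distr_distr[OF L T']
    by (rule arg_cong[where f = "distr \<mu> borel"])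
       (auto simp: fun_eq_iff algebra_simps)
qed

definition ac_setting ::
  "real \<Rightarrow> ('a::euclidean_space measure \<Rightarrow> 'a measure \<Rightarrow> ('a \<times> 'a) measure)
    \<Rightarrow> ('a measure \<Rightarrow> 'a measure \<Rightarrow> 'a \<Rightarrow> 'a) \<Rightarrow> nat \<Rightarrow> (nat \<Rightarrow> int \<Rightarrow> 'a measure) \<Rightarrow> bool" where
  "ac_setting p G T J m \<longleftrightarrow> monge_map_choice p G T \<and>
     (\<forall>l\<le>J. \<forall>i. ac_measure (m l i)) \<and>
     (\<forall>l\<in>{1..J}. \<forall>i. ac_measure (subdivide G (m (l - 1)) i))"

definition ac_minus ::
  "('a::euclidean_space measure \<Rightarrow> 'a measure \<Rightarrow> 'a \<Rightarrow> 'a) \<Rightarrow> 'a measure \<Rightarrow> 'a measure \<Rightarrow> 'a \<Rightarrow> 'a"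
  where "ac_minus T \<nu> \<mu> = (\<lambda>x. T \<mu> \<nu> x - x)"

definition ac_size :: "real \<Rightarrow> 'a::euclidean_space measure \<Rightarrow> ('a \<Rightarrow> 'a) \<Rightarrow> real" where
  "ac_size p \<mu> f = (\<integral>x. norm (f x) powr p \<partial>\<mu>) powr (1 / p)"

definition ac_detail ::
  "('a::euclidean_space measure \<Rightarrow> 'a measure \<Rightarrow> ('a \<times> 'a) measure)
    \<Rightarrow> ('a measure \<Rightarrow> 'a measure \<Rightarrow> 'a \<Rightarrow> 'a) \<Rightarrow> (nat \<Rightarrow> int \<Rightarrow> 'a measure)
    \<Rightarrow> nat \<Rightarrow> int \<Rightarrow> 'a \<Rightarrow> 'a" where
  "ac_detail G T m l i = ac_minus T (m l i) (subdivide G (m (l - 1)) i)"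

definition ac_detail_norm ::
  "real \<Rightarrow> ('a::euclidean_space measure \<Rightarrow> 'a measure \<Rightarrow> ('a \<times> 'a) measure)
    \<Rightarrow> ('a measure \<Rightarrow> 'a measure \<Rightarrow> 'a \<Rightarrow> 'a) \<Rightarrow> (nat \<Rightarrow> int \<Rightarrow> 'a measure) \<Rightarrow> nat \<Rightarrow> ennreal" where
  "ac_detail_norm p G T m l =
     (SUP i. ennreal (ac_size p (subdivide G (m (l - 1)) i) (ac_detail G T m l i)))"

section \<open>Discrete setting\<close>

definition atoms :: "'a::euclidean_space measure \<Rightarrow> 'a set" where
  "atoms \<mu> = {x. measure \<mu> {x} \<noteq> 0}"

definition finitely_supported :: "'a::euclidean_space measure \<Rightarrow> bool" where
  "finitely_supported \<mu> \<longleftrightarrow> finite (atoms \<mu>) \<and> measure \<mu> (atoms \<mu>) = 1"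

definition discrete_setting :: "nat \<Rightarrow> (nat \<Rightarrow> int \<Rightarrow> 'a::euclidean_space measure) \<Rightarrow> bool" where
  "discrete_setting J m \<longleftrightarrow> (\<forall>l\<le>J. \<forall>i. finitely_supported (m l i))"

text \<open>Matrices are indexed by the support points themselves instead of by an enumeration of them:
  the entry of the coupling matrix at the points \<open>x\<close> and \<open>y\<close> is the mass that the
  chosen optimal plan gives to \<open>(x, y)\<close>.\<close>

definition coupling_matrix ::
  "('a::euclidean_space measure \<Rightarrow> 'a measure \<Rightarrow> ('a \<times> 'a) measure)
    \<Rightarrow> 'a measure \<Rightarrow> 'a measure \<Rightarrow> 'a \<Rightarrow> 'a \<Rightarrow> real" where
  "coupling_matrix G \<mu> \<nu> x y = measure (G \<mu> \<nu>) {(x, y)}"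

lemma mccann_discrete:
  fixes \<mu> \<nu> :: "'a::euclidean_space measure"
  assumes "optimal_plan p \<mu> \<nu> (G \<mu> \<nu>)" "finitely_supported \<mu>" "finitely_supported \<nu>"
    and A: "A \<in> sets borel"
  shows "measure (mccann G \<mu> \<nu> t) A =
    (\<Sum>x\<in>atoms \<mu>. \<Sum>y\<in>atoms \<nu>.
       coupling_matrix G \<mu> \<nu> x y * indicator A ((1 - t) *\<^sub>R x + t *\<^sub>R y))"
proof -
  define \<gamma> where "\<gamma> = G \<mu> \<nu>"
  define f :: "'a \<times> 'a \<Rightarrow> 'a" where "f = (\<lambda>(x, y). (1 - t) *\<^sub>R x + t *\<^sub>R y)"
  have ps: "prob_space \<gamma>" and sg: "sets \<gamma> = sets borel"
    and e1: "distr \<gamma> borel fst = \<mu>" and e2: "distr \<gamma> borel snd = \<nu>"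
    using assms(1) by (auto simp: optimal_plan_def couplings_def \<gamma>_def)
  interpret prob_space \<gamma> by (rule ps)
  have sp: "space \<gamma> = UNIV" using sets_eq_imp_space_eq[OF sg] by simp
  have m1: "fst \<in> measurable \<gamma> borel" and m2: "snd \<in> measurable \<gamma> borel"
    and mf: "f \<in> measurable \<gamma> borel"
    unfolding measurable_cong_sets[OF sg refl] f_def split_beta
    by (intro borel_measurable_continuous_onI continuous_intros)+
  have f1: "finite (atoms \<mu>)" and f2: "finite (atoms \<nu>)"
    and u1: "measure \<mu> (atoms \<mu>) = 1" and u2: "measure \<nu> (atoms \<nu>) = 1"
    using assms(2,3) by (auto simp: finitely_supported_def)
  have b1: "atoms \<mu> \<in> sets borel" and b2: "atoms \<nu> \<in> sets borel"
    using f1 f2 by (auto intro: borel_closed finite_imp_closed)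
  have "prob (fst -` atoms \<mu> \<inter> space \<gamma>) = 1"
    using measure_distr[OF m1 b1] u1 by (simp add: e1)
  moreover have "prob (snd -` atoms \<nu> \<inter> space \<gamma>) = 1"
    using measure_distr[OF m2 b2] u2 by (simp add: e2)
  ultimately have "AE z in \<gamma>. z \<in> fst -` atoms \<mu> \<inter> space \<gamma>"
    "AE z in \<gamma>. z \<in> snd -` atoms \<nu> \<inter> space \<gamma>"
    using AE_prob_1 by blast+
  then have ae: "AE z in \<gamma>. z \<in> atoms \<mu> \<times> atoms \<nu>"
    by eventually_elim (auto simp: mem_Times_iff)
  define S where "S = {z \<in> atoms \<mu> \<times> atoms \<nu>. f z \<in> A}"
  have fS: "finite S" unfolding S_def using f1 f2 by simp
  have sS: "B \<in> sets \<gamma>" if "B \<subseteq> S" for B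
    unfolding sg using finite_subset[OF that fS] by (auto intro: borel_closed finite_imp_closed)
  have "measure (mccann G \<mu> \<nu> t) A = prob (f -` A \<inter> space \<gamma>)"
    unfolding mccann_def using measure_distr[OF mf A] by (simp add: f_def \<gamma>_def)
  also have "\<dots> = prob S"
  proof (rule finite_measure_eq_AE)
    show "AE z in \<gamma>. z \<in> f -` A \<inter> space \<gamma> \<longleftrightarrow> z \<in> S"
      using ae by eventually_elim (auto simp: S_def sp)
    show "f -` A \<inter> space \<gamma> \<in> sets \<gamma>" using measurable_sets[OF mf A] .
    show "S \<in> sets \<gamma>" using sS by blast
  qed
  also have "\<dots> = (\<Sum>z\<in>S. prob {z})"
    by (rule finite_measure_eq_sum_singleton[OF fS]) (use sS in auto)
  also have "\<dots> = (\<Sum>z\<in>atoms \<mu> \<times> atoms \<nu>. prob {z} * indicator A (f z))"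
    unfolding S_def using f1 f2 by (intro sum.mono_neutral_cong_left) auto
  also have "\<dots> = (\<Sum>x\<in>atoms \<mu>. \<Sum>y\<in>atoms \<nu>. prob {(x, y)} * indicator A (f (x, y)))"
    by (simp add: sum.cartesian_product split_beta)
  finally show ?thesis by (simp add: coupling_matrix_def \<gamma>_def f_def)
qed

definition discrete_minus ::
  "('a::euclidean_space measure \<Rightarrow> 'a measure \<Rightarrow> ('a \<times> 'a) measure)
    \<Rightarrow> 'a measure \<Rightarrow> 'a measure \<Rightarrow> ('a \<Rightarrow> 'a \<Rightarrow> 'a) \<times> ('a \<Rightarrow> 'a \<Rightarrow> real)" where
  "discrete_minus G \<nu> \<mu> = ((\<lambda>x y. y - x), coupling_matrix G \<mu> \<nu>)"

definition discrete_size ::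
  "real \<Rightarrow> 'a set \<Rightarrow> 'a set \<Rightarrow> ('a::euclidean_space \<Rightarrow> 'a \<Rightarrow> 'a) \<times> ('a \<Rightarrow> 'a \<Rightarrow> real) \<Rightarrow> real" where
  "discrete_size p A B \<psi> =
     (\<Sum>x\<in>A. \<Sum>y\<in>B. norm (fst \<psi> x y) powr p * snd \<psi> x y) powr (1 / p)"

definition discrete_detail ::
  "('a::euclidean_space measure \<Rightarrow> 'a measure \<Rightarrow> ('a \<times> 'a) measure)
    \<Rightarrow> (nat \<Rightarrow> int \<Rightarrow> 'a measure) \<Rightarrow> nat \<Rightarrow> int \<Rightarrow> ('a \<Rightarrow> 'a \<Rightarrow> 'a) \<times> ('a \<Rightarrow> 'a \<Rightarrow> real)" where
  "discrete_detail G m l i = discrete_minus G (m l i) (subdivide G (m (l - 1)) i)"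

definition discrete_detail_norm ::
  "real \<Rightarrow> ('a::euclidean_space measure \<Rightarrow> 'a measure \<Rightarrow> ('a \<times> 'a) measure)
    \<Rightarrow> (nat \<Rightarrow> int \<Rightarrow> 'a measure) \<Rightarrow> nat \<Rightarrow> ennreal" where
  "discrete_detail_norm p G m l =
     (SUP i. ennreal (discrete_size p (atoms (subdivide G (m (l - 1)) i)) (atoms (m l i))
        (discrete_detail G m l i)))"

end

theory Submission
  imports Defs
begin

text \<open>At even grid points the prediction reproduces the sample. At an odd grid point the prediction is
  the midpoint of a geodesic between the two neighbouring samples, so the triangle inequality bounds
  its distance to the sample by half a coarse step plus a fine step, that is by
  \<open>\<Gamma> / 2^l + \<Gamma> / 2^l\<close>, once the curve is known to be \<open>\<Gamma>\<close>-Lipschitz. For the Lipschitz bound, the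
  distances to the points of the curve with rational parameter are absolutely continuous functions of
  time; the supremum of their derivatives is almost everywhere the metric derivative, hence at most
  \<open>\<Gamma>\<close>, and its integral bounds the distance travelled. The triangle inequality is obtained by gluing
  plans along a fine countable partition and letting the mesh tend to \<open>0\<close>.\<close>

section \<open>Absolutely continuous functions on the line\<close>

text \<open>\<open>H\<close> is a locally absolutely continuous function with density
  \<open>h\<close>. Stating this through increments fixes no base point or additive
  constant.\<close>

definition primitive :: "(real \<Rightarrow> real) \<Rightarrow> (real \<Rightarrow> real) \<Rightarrow> bool" where
  "primitive H h \<longleftrightarrow>
     (\<forall>s t. s \<le> t \<longrightarrow> h absolutely_integrable_on {s..t} \<and> H t - H s = integral {s..t} h)"

lemma primitiveD:
  assumes "primitive H h" "s \<le> t"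
  shows "h absolutely_integrable_on {s..t}" "h integrable_on {s..t}" "H t - H s = integral {s..t} h"
  using assms by (auto simp: primitive_def intro: set_lebesgue_integral_eq_integral(1))

lemma primitive_exists:
  assumes "\<And>a b. h absolutely_integrable_on {a..b}"
  shows "\<exists>H. primitive H h"
proof
  have i: "h integrable_on {a..b}" for a b
    using assms[of a b] set_lebesgue_integral_eq_integral(1) by blast
  \<comment> \<open>The witness is the signed integral from 0: an integral over a reversed interval
    is 0, so only one of the two terms survives on each side of 0.\<close>
  show "primitive (\<lambda>t. integral {0..t} h - integral {t..0} h) h"
    unfolding primitive_def
  proof (intro allI impI conjI)
    fix s t :: real assume "s \<le> t"
    have c: "integral {a..x} h + integral {x..b} h = integral {a..b} h" if "a \<le> x" "x \<le> b" for a b x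
      using that i by (rule Henstock_Kurzweil_Integration.integral_combine)
    have z: "integral {a..b} h = 0" if "b \<le> a" for a b
      using that by (cases "a = b") auto
    consider "0 \<le> s" | "s \<le> 0" "0 \<le> t" | "t \<le> 0" using \<open>s \<le> t\<close> by linarith
    then show "integral {0..t} h - integral {t..0} h - (integral {0..s} h - integral {s..0} h)
      = integral {s..t} h"
      using c[of 0 s t] c[of s 0 t] c[of s t 0] z[of 0 s] z[of 0 t] z[of s 0] z[of t 0] \<open>s \<le> t\<close>
      by cases auto
  qed (rule assms)
qed

lemma primitive_continuous:
  assumes "primitive H h"
  shows "continuous_on UNIV H"
proof -
  have "isCont H x" for x
  proof -
    have "continuous_on {x-1..x+1} (\<lambda>y. H (x-1) + integral {x-1..y} h)"
      by (intro continuous_intros indefinite_integral_continuous_1 primitiveD(2)[OF assms]) auto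
    then have "continuous_on {x-1..x+1} H"
      by (rule continuous_on_eq) (use primitiveD(3)[OF assms, of "x-1"] in force)
    then have "continuous_on {x-1<..<x+1} H"
      by (rule continuous_on_subset) auto
    then show ?thesis
      by (simp add: continuous_on_eq_continuous_at)
  qed
  then show ?thesis by (simp add: continuous_on_eq_continuous_at)
qed

section \<open>Lebesgue differentiation of primitives\<close>

text \<open>The differentiation theorem used here averages over cubes with lower corner
  \<open>x\<close>. In dimension one these are intervals to the right of \<open>x\<close>, so it
  yields a one-sided derivative.\<close>

lemma primitive_right_derivative:
  assumes "primitive H h"
  shows "AE x in lebesgue. ((\<lambda>y. (H (x + y) - H x) / y) \<longlongrightarrow> h x) (at_right 0)"
proof -
  have "h integrable_on cbox a b" for a b
    using primitiveD(2)[OF assms, of a b] by (cases "a \<le> b") (auto simp: not_le)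
  from integrable_ccontinuous_explicit[OF this] obtain N where N: "negligible N"
    and *: "\<And>x e. \<lbrakk>x \<notin> N; 0 < e\<rbrakk> \<Longrightarrow> \<exists>d>0. \<forall>y. 0 < y \<and> y < d \<longrightarrow>
              norm (integral (cbox x (x + y *\<^sub>R One)) h /\<^sub>R y ^ DIM(real) - h x) < e" by blast
  show ?thesis
  proof (rule AE_I')
    show "N \<in> null_sets lebesgue" using N by (simp add: negligible_iff_null_sets)
    show "{x \<in> space lebesgue. \<not> ((\<lambda>y. (H (x + y) - H x) / y) \<longlongrightarrow> h x) (at_right 0)} \<subseteq> N"
    proof (rule subsetI, rule ccontr)
      fix x assume x: "x \<in> {x \<in> space lebesgue. \<not> ((\<lambda>y. (H (x + y) - H x) / y) \<longlongrightarrow> h x) (at_right 0)}"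
        and "x \<notin> N"
      have "((\<lambda>y. (H (x + y) - H x) / y) \<longlongrightarrow> h x) (at_right 0)"
      proof (rule tendstoI)
        fix e :: real assume "e > 0"
        from *[OF \<open>x \<notin> N\<close> this] obtain d where "d > 0"
          and d: "\<And>y. 0 < y \<Longrightarrow> y < d \<Longrightarrow>
            norm (integral (cbox x (x + y *\<^sub>R One)) h /\<^sub>R y ^ DIM(real) - h x) < e" by blast
        show "\<forall>\<^sub>F y in at_right 0. dist ((H (x + y) - H x) / y) (h x) < e"
          unfolding eventually_at_right_field
        proof (intro exI[of _ d] conjI allI impI)
          fix y :: real assume "0 < y" "y < d"
          then show "dist ((H (x + y) - H x) / y) (h x) < e"
            using d[of y] primitiveD(3)[OF assms, of x "x + y"] by (simp add: dist_real_def field_simps)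
        qed fact
      qed
      then show False using x by blast
    qed
  qed
qed

text \<open>Serves to obtain left derivatives from right ones. The outer minus sign cancels the one
  coming from the reflected argument, so the density keeps its sign.\<close>

lemma primitive_reflect:
  assumes "primitive H h"
  shows "primitive (\<lambda>t. - H (- t)) (\<lambda>t. h (- t))"
  unfolding primitive_def
proof (intro allI impI conjI)
  fix s t :: real assume "s \<le> t"
  then have st: "-t \<le> -s" by simp
  show "(\<lambda>t. h (- t)) absolutely_integrable_on {s..t}"
    using primitiveD(1)[OF assms st]
    using absolutely_integrable_reflect_real[where f=h and a="-t" and b="-s"] by simp
  show "- H (- t) - - H (- s) = integral {s..t} (\<lambda>t. h (- t))"
    using primitiveD(3)[OF assms st] Henstock_Kurzweil_Integration.integral_reflect_real[of "-s" "-t" h] by simp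
qed

text \<open>Reflection is differentiable and therefore maps negligible sets to negligible
  sets.\<close>

lemma AE_lebesgue_reflect:
  assumes "AE x in lebesgue. P (x::real)"
  shows "AE x in lebesgue. P (- x)"
proof -
  from assms obtain N where N: "N \<in> null_sets lebesgue" "{x. \<not> P x} \<subseteq> N"
    by (auto simp: eventually_ae_filter)
  have "negligible (uminus ` N)"
    using N(1) by (intro negligible_differentiable_image_negligible)
      (auto simp: negligible_iff_null_sets differentiable_on_def intro!: derivative_intros)
  then show ?thesis
  proof (intro AE_I'[of "uminus ` N"] subsetI)
    fix x assume "x \<in> {x \<in> space lebesgue. \<not> P (- x)}"
    then have "- x \<in> N" using N(2) by auto
    then show "x \<in> uminus ` N" by (intro image_eqI[of _ _ "- x"]) auto
  qed (simp add: negligible_iff_null_sets)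
qed

text \<open>The left difference quotient of \<open>H\<close> at \<open>x\<close> is the right
  difference quotient of the reflected primitive at \<open>- x\<close>, so both one-sided limits
  equal \<open>h x\<close> almost everywhere.\<close>

lemma primitive_has_derivative:
  assumes "primitive H h"
  shows "AE x in lebesgue. (H has_real_derivative h x) (at x)"
  using primitive_right_derivative[OF assms]
    AE_lebesgue_reflect[OF primitive_right_derivative[OF primitive_reflect[OF assms]]]
proof eventually_elim
  case (elim x)
  have "((\<lambda>y. (H (x + y) - H x) / y) \<longlongrightarrow> h x) (at_left 0)"
    unfolding filterlim_at_left_to_right using elim(2)
    by (simp add: minus_divide_right[symmetric] minus_divide_left minus_diff_eq add.commute)
  with elim(1) show ?case
    unfolding has_field_derivative_def[symmetric] DERIV_def by (simp add: filterlim_at_split)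
qed

section \<open>Functions dominated by a primitive, via Stieltjes measures\<close>

lemma has_integral_Ioc_iff:
  fixes f :: "real \<Rightarrow> real"
  shows "(f has_integral y) {a<..b} \<longleftrightarrow> (f has_integral y) {a..b}"
  by (rule has_integral_spike_set_eq) (auto intro: negligible_subset[of "{a}"])

lemma nn_integral_primitive:
  assumes "primitive H h" "\<And>x. 0 \<le> h x" "a \<le> b"
  shows "(\<integral>\<^sup>+x. ennreal (h x) * indicator {a<..b} x \<partial>lborel) = ennreal (H b - H a)"
proof (rule nn_integral_has_integral_lebesgue')
  have "(h has_integral (H b - H a)) {a..b}"
    using primitiveD(2,3)[OF assms(1,3)] by (simp add: has_integral_integrable_integral)
  then show "(h has_integral (H b - H a)) {a<..b}"
    by (rule has_integral_Ioc_iff[THEN iffD2])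
qed (rule assms)

lemma primitiveI_nn_integral:
  assumes [measurable]: "k \<in> borel_measurable borel" and k: "\<And>x. 0 \<le> k x"
    and K: "\<And>a b. a \<le> b \<Longrightarrow> K a \<le> K b"
      "\<And>a b. a \<le> b \<Longrightarrow> (\<integral>\<^sup>+x. ennreal (k x) * indicator {a<..b} x \<partial>lborel) = ennreal (K b - K a)"
  shows "primitive K k"
proof -
  have "(k has_integral (K b - K a)) {a..b}" if "a \<le> b" for a b
  proof -
    have "((\<lambda>x. k x * indicator {a<..b} x) has_integral (K b - K a)) UNIV"
    proof (rule nn_integral_has_integral)
      show "(\<integral>\<^sup>+ x. ennreal (k x * indicator {a<..b} x) \<partial>lborel) = ennreal (K b - K a)"
        unfolding K(2)[OF that, symmetric]
        by (intro nn_integral_cong) (auto simp: indicator_def)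
    qed (use k K(1)[OF that] in auto)
    also have "(\<lambda>x. k x * indicator {a<..b} x) = (\<lambda>x. if x \<in> {a<..b} then k x else 0)"
      by (auto simp: fun_eq_iff indicator_def)
    finally have "(k has_integral (K b - K a)) {a<..b}"
      by (simp only: has_integral_restrict_UNIV)
    then show ?thesis
      by (rule has_integral_Ioc_iff[THEN iffD1])
  qed
  note * = this
  show ?thesis
    unfolding primitive_def
  proof (intro allI impI conjI)
    fix s t :: real assume st: "s \<le> t"
    show "k absolutely_integrable_on {s..t}"
      using k has_integral_integrable[OF *[OF st]] by (intro nonnegative_absolutely_integrable_1) auto
    show "K t - K s = integral {s..t} k"
      using integral_unique[OF *[OF st]] by simp
  qed
qed

lemma primitive_diff:
  assumes "primitive H h" "primitive K k"
  shows "primitive (\<lambda>t. H t - K t) (\<lambda>t. h t - k t)"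
  unfolding primitive_def
proof (intro allI impI conjI)
  fix s t :: real assume st: "s \<le> t"
  note H = primitiveD[OF assms(1) st] and K = primitiveD[OF assms(2) st]
  show "(\<lambda>t. h t - k t) absolutely_integrable_on {s..t}"
    using H(1) K(1) by (rule set_integral_diff)
  show "H t - K t - (H s - K s) = integral {s..t} (\<lambda>t. h t - k t)"
    using H(2,3) K(2,3) by (simp add: Henstock_Kurzweil_Integration.integral_diff)
qed

text \<open>The Stieltjes measures of \<open>F\<close> and \<open>G\<close> add up to the measure
  with density \<open>h\<close>. The one of \<open>F\<close> is thus dominated by an absolutely
  continuous measure, and its Radon-Nikodym derivative is the density sought.\<close>

lemma primitive_density:
  fixes F G :: "real \<Rightarrow> real"
  assumes H: "primitive H h" and [measurable]: "h \<in> borel_measurable borel" and h: "\<And>x. 0 \<le> h x"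
    and mono: "\<And>s t. s \<le> t \<Longrightarrow> F s \<le> F t" "\<And>s t. s \<le> t \<Longrightarrow> G s \<le> G t"
    and cont: "continuous_on UNIV F" "continuous_on UNIV G"
    and sum: "\<And>t. F t + G t = H t"
  shows "\<exists>k \<in> borel_measurable borel. primitive F k"
proof -
  define M N where "M = interval_measure F" and "N = interval_measure G"
  define S where "S = measure_of UNIV (sets borel) (\<lambda>A. emeasure M A + emeasure N A)"
  have sM[measurable_cong]: "sets M = sets borel" and sN[measurable_cong]: "sets N = sets borel"
    and sS[measurable_cong]: "sets S = sets borel"
    by (simp_all add: M_def N_def S_def sets.sigma_sets_eq[of borel, simplified])
  have eS: "emeasure S A = emeasure M A + emeasure N A" if "A \<in> sets borel" for A
    unfolding S_def
  proof (rule emeasure_measure_of_sigma)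
    show "sigma_algebra UNIV (sets (borel :: real measure))"
      using sets.sigma_algebra_axioms[of "borel :: real measure"] by simp
    show "positive (sets borel) (\<lambda>A. emeasure M A + emeasure N A)"
      by (simp add: positive_def)
    show "countably_additive (sets borel) (\<lambda>A. emeasure M A + emeasure N A)"
      by (intro countably_additiveI)
        (simp add: suminf_add[symmetric] suminf_emeasure sM sN)
  qed fact
  have rc: "continuous (at_right a) F" "continuous (at_right a) G" for a
    using cont by (auto simp: continuous_on_eq_continuous_at intro: continuous_at_imp_continuous_at_within)
  have eM: "emeasure M {a<..b} = ennreal (F b - F a)" if "a \<le> b" for a b
    unfolding M_def using that mono rc by (intro emeasure_interval_measure_Ioc) auto
  have eN: "emeasure N {a<..b} = ennreal (G b - G a)" if "a \<le> b" for a b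
    unfolding N_def using that mono rc by (intro emeasure_interval_measure_Ioc) auto
  have eD: "emeasure (density lborel h) {a<..b} = ennreal (H b - H a)" if "a \<le> b" for a b
    using nn_integral_primitive[OF H h that] by (simp add: emeasure_density)
  \<comment> \<open>Half-open intervals form an intersection-stable generator of the Borel sets, and
    both measures give them the increment of \<open>H\<close>, finite on an exhausting
    sequence.\<close>
  have S: "S = density lborel h"
  proof (rule measure_eqI_generator_eq[where \<Omega>=UNIV])
    show "emeasure S X = emeasure (density lborel h) X" if X: "X \<in> range (\<lambda>(a, b). {a<..b::real})" for X
    proof -
      obtain a b where "X = {a<..b}" using X by auto
      moreover have "emeasure S {a<..b} = emeasure (density lborel h) {a<..b}" if "a \<le> b"
        using mono[OF that] eM[OF that] eN[OF that] eD[OF that] sum[of a] sum[of b]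
        by (simp add: eS ennreal_plus[symmetric] del: ennreal_plus)
      ultimately show ?thesis by (cases "a \<le> b") auto
    qed
    show "(\<Union>i. {- real (i::nat)<..real i}) = UNIV"
      by (rule UN_Ioc_eq_UNIV)
    show "emeasure S {- real (i::nat)<..real i} \<noteq> \<infinity>" for i
      by (simp add: eS eM eN)
  qed (auto simp: sS borel_sigma_sets_Ioc Int_stable_def)
  have ac: "absolutely_continuous lborel M"
    unfolding absolutely_continuous_def
  proof
    fix A :: "real set" assume A: "A \<in> null_sets lborel"
    then have [measurable]: "A \<in> sets borel" by (auto dest: null_setsD2)
    have "A \<in> null_sets (density lborel h)"
      using A absolutely_continuousI_density[of "\<lambda>x. ennreal (h x)" lborel]
      by (auto simp: absolutely_continuous_def)
    then have "emeasure S A = 0" unfolding S by auto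
    then show "A \<in> null_sets M" by (auto simp: eS sM)
  qed
  have sf: "sigma_finite_measure M"
    unfolding M_def using mono rc by (intro sigma_finite_interval_measure) auto
  define f where "f = RN_deriv lborel M"
  have [measurable]: "f \<in> borel_measurable borel"
    using borel_measurable_RN_deriv[of lborel M] by (simp add: f_def)
  have dens: "density lborel f = M"
    unfolding f_def by (rule sigma_finite_measure.density_RN_deriv[OF lborel.sigma_finite_measure_axioms ac]) (simp add: sM)
  \<comment> \<open>The derivative takes extended values; since it is finite almost everywhere,
    passing to \<open>enn2real\<close> does not change its integrals.\<close>
  have fin: "AE x in lborel. f x \<noteq> \<infinity>"
    unfolding f_def by (rule sigma_finite_measure.RN_deriv_finite[OF lborel.sigma_finite_measure_axioms sf ac]) (simp add: sM)
  show ?thesis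
  proof (intro bexI primitiveI_nn_integral)
    show "(\<integral>\<^sup>+x. ennreal (enn2real (f x)) * indicator {a<..b} x \<partial>lborel) = ennreal (F b - F a)"
      if "a \<le> b" for a b
    proof -
      have "(\<integral>\<^sup>+x. ennreal (enn2real (f x)) * indicator {a<..b} x \<partial>lborel)
          = (\<integral>\<^sup>+x. f x * indicator {a<..b} x \<partial>lborel)"
        using fin by (intro nn_integral_cong_AE) (auto simp: less_top)
      also have "\<dots> = emeasure M {a<..b}"
        unfolding dens[symmetric] by (subst emeasure_density) auto
      finally show ?thesis using eM[OF that] by simp
    qed
  qed (use mono in auto)
qed

text \<open>The domination makes \<open>H + F\<close> and \<open>H - F\<close> nondecreasing and
  continuous, and they sum to \<open>2 * H\<close>. So \<open>primitive_density\<close> applies to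
  \<open>H + F\<close>, and subtracting \<open>H\<close> gives a density of
  \<open>F\<close>.\<close>

lemma dominated_imp_primitive:
  assumes H: "primitive H h" and [measurable]: "h \<in> borel_measurable borel" and h: "\<And>x. 0 \<le> h x"
    and F: "\<And>s t. s \<le> t \<Longrightarrow> \<bar>F t - F s\<bar> \<le> H t - H s"
  shows "\<exists>k \<in> borel_measurable borel. primitive F k"
proof -
  note cH = primitive_continuous[OF H]
  have cF: "continuous_on UNIV F"
    unfolding continuous_on_def
  proof
    fix x
    have "((\<lambda>y. H y - H x) \<longlongrightarrow> H x - H x) (at x)"
      using cH by (intro tendsto_intros) (auto simp: continuous_on_def)
    then have "((\<lambda>y. \<bar>H y - H x\<bar>) \<longlongrightarrow> 0) (at x)"
      by (intro tendsto_rabs_zero) simp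
    moreover have "norm (F y - F x) \<le> \<bar>H y - H x\<bar>" for y
      using F[of x y] F[of y x] by (cases "x \<le> y") auto
    ultimately have "((\<lambda>y. F y - F x) \<longlongrightarrow> 0) (at x)"
      by (rule Lim_null_comparison[OF always_eventually, OF allI, rotated])
    then show "(F \<longlongrightarrow> F x) (at x)" by (simp add: LIM_zero_iff)
  qed
  have H2: "primitive (\<lambda>t. 2 * H t) (\<lambda>t. 2 * h t)"
    unfolding primitive_def
  proof (intro allI impI conjI)
    fix s t :: real assume st: "s \<le> t"
    show "(\<lambda>t. 2 * h t) absolutely_integrable_on {s..t}"
      by (intro set_integrable_mult_right primitiveD(1)[OF H st])
    show "2 * H t - 2 * H s = integral {s..t} (\<lambda>t. 2 * h t)"
      using primitiveD(3)[OF H st] by simp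
  qed
  have "\<exists>k \<in> borel_measurable borel. primitive (\<lambda>t. H t + F t) k"
  proof (rule primitive_density[OF H2, where G = "\<lambda>t. H t - F t"])
    show "H s + F s \<le> H t + F t" "H s - F s \<le> H t - F t" if "s \<le> t" for s t
      using F[OF that] by auto
  qed (use h cH cF in \<open>auto intro!: continuous_intros\<close>)
  then obtain k where [measurable]: "k \<in> borel_measurable borel" and "primitive (\<lambda>t. H t + F t) k" by blast
  from primitive_diff[OF this(2) H] show ?thesis by (intro bexI[of _ "\<lambda>t. k t - h t"]) auto
qed

lemma primitive_mono_AE:
  assumes F: "primitive F f" and K: "primitive K k" and le: "AE x in lebesgue. f x \<le> k x" and st: "s \<le> t"
  shows "F t - F s \<le> K t - K s"
proof -
  note f = primitiveD[OF F st] and k = primitiveD[OF K st]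
  have "(LINT x:{s..t}|lebesgue. f x) \<le> (LINT x:{s..t}|lebesgue. k x)"
    unfolding set_lebesgue_integral_def
  proof (rule integral_mono_AE)
    show "AE x in lebesgue. indicator {s..t} x *\<^sub>R f x \<le> indicator {s..t} x *\<^sub>R k x"
      using le by eventually_elim (auto simp: indicator_def)
  qed (use f(1) k(1) in \<open>simp_all add: set_integrable_def\<close>)
  then show ?thesis
    using f(3) k(3) set_lebesgue_integral_eq_integral(2)[OF f(1)] set_lebesgue_integral_eq_integral(2)[OF k(1)]
    by simp
qed

text \<open>The integrand witnessing absolute continuity of a curve may be merely Lebesgue
  measurable and may change sign. The absolute value of a Borel version of it supplies the
  nonnegative Borel density that the Stieltjes argument requires.\<close>

lemma borel_primitive_majorant:
  assumes g: "\<And>a b. g absolutely_integrable_on {a..b::real}"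
  shows "\<exists>K k. primitive K k \<and> k \<in> borel_measurable borel \<and> (\<forall>x. 0 \<le> k x) \<and>
           (\<forall>s t. s \<le> t \<longrightarrow> integral {s..t} g \<le> K t - K s)"
proof -
  \<comment> \<open>Local integrability gives measurability of the truncations to bounded intervals;
    \<open>g\<close> is their pointwise limit.\<close>
  have "(\<lambda>x. indicator {-real n..real n} x *\<^sub>R g x) \<in> borel_measurable lebesgue" for n :: nat
    using g[of "-real n" "real n"] by (auto simp: set_integrable_def)
  then have "g \<in> borel_measurable lebesgue"
  proof (rule borel_measurable_LIMSEQ_real[rotated])
    fix x :: real
    obtain N :: nat where N: "\<bar>x\<bar> \<le> real N" using real_arch_simple by blast
    have "\<forall>\<^sub>F n in sequentially. indicator {-real n..real n} x *\<^sub>R g x = g x"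
      using eventually_ge_at_top[of N] by eventually_elim (use N in \<open>auto simp: indicator_def\<close>)
    then show "(\<lambda>n. indicator {-real n..real n} x *\<^sub>R g x) \<longlonglongrightarrow> g x"
      by (rule tendsto_eventually)
  qed
  then obtain g' where [measurable]: "g' \<in> borel_measurable borel" and eq: "AE x in lborel. g x = g' x"
    using completion_ex_borel_measurable_real[of g lborel] by auto
  have eq': "AE x in lebesgue. g x = g' x"
    using eq by (rule AE_completion)
  define k where "k = (\<lambda>x. \<bar>g' x\<bar>)"
  have k[measurable]: "k \<in> borel_measurable borel" unfolding k_def by measurable
  have ki: "k absolutely_integrable_on {a..b}" for a b
  proof -
    have "(\<lambda>x. \<bar>g x\<bar>) absolutely_integrable_on {a..b}"
      using g by (rule set_integrable_abs)
    moreover have "(\<lambda>x. indicator {a..b} x *\<^sub>R k x) \<in> borel_measurable lebesgue"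
      by (intro borel_measurable_scaleR borel_measurable_indicator measurable_completion) auto
    moreover have "AE x in lebesgue. indicator {a..b} x *\<^sub>R \<bar>g x\<bar> = indicator {a..b} x *\<^sub>R k x"
      using eq' by eventually_elim (simp add: k_def)
    ultimately show ?thesis
      unfolding set_integrable_def by (rule integrable_cong_AE_imp)
  qed
  obtain K where K: "primitive K k" using primitive_exists[OF ki] by blast
  obtain F where F: "primitive F g" using primitive_exists[OF g] by blast
  have "AE x in lebesgue. g x \<le> k x"
    using eq' by eventually_elim (simp add: k_def)
  from primitive_mono_AE[OF F K this] show ?thesis
    using K k primitiveD(3)[OF F] by (intro exI[of _ K] exI[of _ k]) (auto simp: k_def)
qed

section \<open>Lipschitz bounds from the metric speed\<close>

lemma tendsto_abs_quotient:
  assumes "(F has_real_derivative D) (at x)"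
  shows "((\<lambda>y. \<bar>F (x + y) - F x\<bar> / \<bar>y\<bar>) \<longlongrightarrow> \<bar>D\<bar>) (at 0)"
  using tendsto_rabs[OF assms[unfolded DERIV_def]] by simp

text \<open>The metric derivative exists almost everywhere and equals the supremum of the derivatives of
  the distances to the points of parameter \<open>q \<in> \<rat>\<close>, which are dense in the curve.\<close>

lemma metric_speed_imp_lipschitz:
  fixes W :: "real \<Rightarrow> real \<Rightarrow> real"
  assumes sym: "\<And>s t. W s t = W t s"
    and tri: "\<And>r s t. W r t \<le> W r s + W s t"
    and H: "primitive H g" and [measurable]: "g \<in> borel_measurable borel" and g: "\<And>x. 0 \<le> g x"
    and ac: "\<And>s t. s \<le> t \<Longrightarrow> W s t \<le> H t - H s"
    and speed: "\<And>t D. ((\<lambda>y. W (t + y) t / \<bar>y\<bar>) \<longlongrightarrow> D) (at 0) \<Longrightarrow> D \<le> \<Gamma>"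
    and st: "s \<le> t"
  shows "W s t \<le> \<Gamma> * (t - s)"
proof -
  have abs_tri: "\<bar>W q t - W q s\<bar> \<le> W s t" for q s t
    using tri[of q t s] tri[of q s t] sym[of s t] by auto
  \<comment> \<open>By the reverse triangle inequality the increments of \<open>W q\<close> are
    bounded by those of \<open>H\<close>.\<close>
  have "\<exists>h \<in> borel_measurable borel. primitive (W q) h" for q
    by (rule dominated_imp_primitive[OF H _ g]) (auto intro: order_trans[OF abs_tri ac])
  then obtain h where h[measurable]: "\<And>q. h q \<in> borel_measurable borel" and Wh: "\<And>q. primitive (W q) (h q)"
    by metis
  \<comment> \<open>Truncating at \<open>g x\<close> keeps the family bounded at every
    \<open>x\<close>, so that the real supremum is meaningful everywhere. The truncation is inactive
    almost everywhere by \<open>hg\<close> below.\<close>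
  define m where "m x = (SUP q\<in>\<rat>. min \<bar>h q x\<bar> (g x))" for x
  have ne: "(\<rat> :: real set) \<noteq> {}" using Rats_0 by blast
  have bdd: "bdd_above ((\<lambda>q. min \<bar>h q x\<bar> (g x)) ` \<rat>)" for x
    by (rule bdd_aboveI[of _ "g x"]) auto
  have le_m: "min \<bar>h q x\<bar> (g x) \<le> m x" if "q \<in> \<rat>" for q x
    unfolding m_def using that bdd by (rule cSUP_upper)
  have m0: "0 \<le> m x" for x
    using le_m[OF Rats_0, of x] g[of x] by linarith
  have m_le: "m x \<le> g x" for x
    unfolding m_def using ne by (rule cSUP_least) auto
  have m[measurable]: "m \<in> borel_measurable borel"
    unfolding m_def using bdd by (intro borel_measurable_cSUP countable_rat) auto
  have mi: "m absolutely_integrable_on {a..b}" for a b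
  proof (cases "a \<le> b")
    case True
    show ?thesis
    proof (rule measurable_bounded_by_integrable_imp_absolutely_integrable)
      show "m \<in> borel_measurable (lebesgue_on {a..b})"
        using m by (intro measurable_restrict_space1 measurable_completion) simp
      show "g integrable_on {a..b}" using primitiveD(2)[OF H True] .
    qed (use m0 m_le in auto)
  qed (simp add: set_integrable_def)
  then obtain M where M: "primitive M m" using primitive_exists by blast
  have Wh': "AE x in lebesgue. \<forall>q\<in>\<rat>. (W q has_real_derivative h q x) (at x)"
    using primitive_has_derivative[OF Wh] by (simp add: AE_ball_countable countable_rat)
  then have hg: "AE x in lebesgue. \<forall>q\<in>\<rat>. \<bar>h q x\<bar> \<le> g x"
    using primitive_has_derivative[OF H]
  proof eventually_elim
    case (elim x)
    show ?case
    proof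
      fix q :: real assume "q \<in> \<rat>"
      then have "((\<lambda>y. \<bar>W q (x + y) - W q x\<bar> / \<bar>y\<bar>) \<longlongrightarrow> \<bar>h q x\<bar>) (at 0)"
        using elim(1) by (intro tendsto_abs_quotient) auto
      moreover have "((\<lambda>y. \<bar>H (x + y) - H x\<bar> / \<bar>y\<bar>) \<longlongrightarrow> \<bar>g x\<bar>) (at 0)"
        using elim(2) by (intro tendsto_abs_quotient)
      moreover have "\<bar>W q (x + y) - W q x\<bar> \<le> \<bar>H (x + y) - H x\<bar>" for y
        using abs_tri[of q "x + y" x] ac[of x "x + y"] ac[of "x + y" x] sym[of x "x + y"]
        by (cases "0 \<le> y") auto
      ultimately have "\<bar>h q x\<bar> \<le> \<bar>g x\<bar>"
        by (intro tendsto_le[of "at (0::real)"]) (auto intro!: always_eventually divide_right_mono)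
      then show "\<bar>h q x\<bar> \<le> g x" using g[of x] by simp
    qed
  qed
  \<comment> \<open>A rational \<open>q\<close> just to the right of \<open>s\<close> replaces
    \<open>s\<close> as base point. The small distance between them is paid twice, once in the
    triangle inequality and once through \<open>W q s\<close>, hence the halves of
    \<open>e\<close>.\<close>
  have WM: "W s t \<le> M t - M s" if "s \<le> t" for s t
  proof (rule field_le_epsilon)
    fix e :: real assume "e > 0"
    have "continuous (at s) H"
      using primitive_continuous[OF H] by (simp add: continuous_on_eq_continuous_at)
    then obtain d where "d > 0" and d: "\<And>x. dist x s < d \<Longrightarrow> dist (H x) (H s) < e / 2"
      using \<open>e > 0\<close> by (metis continuous_at_eps_delta half_gt_zero)
    obtain q where q: "q \<in> \<rat>" "s < q" "q < s + d"
      using Rats_dense_in_real[of s "s + d"] \<open>d > 0\<close> by auto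
    have "W s q < e / 2"
      using ac[of s q] d[of q] q abs_ge_self[of "H q - H s"] unfolding dist_real_def by linarith
    moreover have "W q t - W q s \<le> M t - M s"
    proof (rule primitive_mono_AE[OF Wh M _ that])
      show "AE x in lebesgue. h q x \<le> m x"
        using hg by eventually_elim (use le_m[OF q(1)] q(1) in \<open>force simp: min_def split: if_splits\<close>)
    qed
    ultimately show "W s t \<le> M t - M s + e"
      using tri[of s t q] sym[of q s] by linarith
  qed
  \<comment> \<open>At almost every \<open>x\<close> the metric derivative exists and equals
    \<open>m x\<close>: the difference quotients of \<open>M\<close> bound the metric quotients from
    above, those of a single \<open>W q\<close> bound them from below. Then \<open>speed\<close>
    applies.\<close>
  have "AE x in lebesgue. m x \<le> \<Gamma>"
    using Wh' hg primitive_has_derivative[OF M]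
  proof eventually_elim
    case (elim x)
    have up: "((\<lambda>y. \<bar>M (x + y) - M x\<bar> / \<bar>y\<bar>) \<longlongrightarrow> m x) (at 0)"
      using tendsto_abs_quotient[OF elim(3)] m0[of x] by simp
    have "W (x + y) x \<le> \<bar>M (x + y) - M x\<bar>" for y
      using WM[of x "x + y"] WM[of "x + y" x] sym[of x "x + y"] by (cases "0 \<le> y") auto
    then have W_up: "W (x + y) x / \<bar>y\<bar> \<le> \<bar>M (x + y) - M x\<bar> / \<bar>y\<bar>" for y
      by (intro divide_right_mono) auto
    have "((\<lambda>y. W (x + y) x / \<bar>y\<bar>) \<longlongrightarrow> m x) (at 0)"
    proof (rule order_tendstoI)
      fix a assume "m x < a"
      from order_tendstoD(2)[OF up this] show "\<forall>\<^sub>F y in at 0. W (x + y) x / \<bar>y\<bar> < a"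
        by eventually_elim (rule le_less_trans[OF W_up])
    next
      fix a assume "a < m x"
      \<comment> \<open>A value below the supremum is exceeded by some truncated term, hence by
        \<open>\<bar>h q x\<bar>\<close> itself.\<close>
      then obtain q where q: "q \<in> \<rat>" "a < \<bar>h q x\<bar>"
        unfolding m_def using less_cSUP_iff[OF ne bdd] by auto
      have "((\<lambda>y. \<bar>W q (x + y) - W q x\<bar> / \<bar>y\<bar>) \<longlongrightarrow> \<bar>h q x\<bar>) (at 0)"
        using elim(1) q(1) by (intro tendsto_abs_quotient) auto
      from order_tendstoD(1)[OF this q(2)] show "\<forall>\<^sub>F y in at 0. a < W (x + y) x / \<bar>y\<bar>"
      proof eventually_elim
        case (elim y)
        also have "\<bar>W q (x + y) - W q x\<bar> / \<bar>y\<bar> \<le> W (x + y) x / \<bar>y\<bar>"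
          using abs_tri[of q "x + y" x] sym[of x "x + y"] by (intro divide_right_mono) auto
        finally show ?case .
      qed
    qed
    then show ?case by (rule speed)
  qed
  moreover have "primitive (\<lambda>t. \<Gamma> * t) (\<lambda>_. \<Gamma>)"
    by (auto simp: primitive_def algebra_simps)
  ultimately have "M t - M s \<le> \<Gamma> * t - \<Gamma> * s"
    using M st by (intro primitive_mono_AE)
  then show ?thesis using WM[OF st] by (simp add: algebra_simps)
qed

section \<open>The Wasserstein distance\<close>

lemma convex_powr_nonneg:
  fixes x y u v p :: real
  assumes "1 \<le> p" "0 \<le> x" "0 \<le> y" "0 \<le> u" "0 \<le> v" "u + v = 1"
  shows "(u * x + v * y) powr p \<le> u * x powr p + v * y powr p"
proof -
  have 1: "(u * x) powr p \<le> u * x powr p" if "0 \<le> u" "u \<le> 1" "0 \<le> x" for u x :: real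
  proof -
    have "u powr p \<le> u powr 1"
      using that assms(1) by (intro powr_mono') auto
    then show ?thesis
      using that by (auto simp: powr_mult intro!: mult_right_mono)
  qed
  \<comment> \<open>Convexity of the power is applied at positive arguments. If one argument
    vanishes, the claim reduces to fact \<open>1\<close>, which rests on the weight being at most
    1.\<close>
  consider "x = 0" | "y = 0" | "0 < x" "0 < y" using assms by linarith
  then show ?thesis
  proof cases
    case 3
    then show ?thesis
      using powr_convex[OF assms(1)] assms unfolding convex_on_def by auto
  qed (use assms 1[of u x] 1[of v y] in auto)
qed

text \<open>The Minkowski inequality in terms of upper bounds \<open>a\<close>, \<open>b\<close> for
  the two norms. It follows by convexity, writing the sum as \<open>a + b\<close> times a convex
  combination of \<open>u / a\<close> and \<open>v / b\<close> with weights
  \<open>a / (a + b)\<close> and \<open>b / (a + b)\<close>. Positive bounds keep the divisions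
  valid even for functions of norm 0.\<close>

lemma integral_powr_add_le:
  fixes u v :: "'b \<Rightarrow> real"
  assumes p: "1 \<le> p" and [measurable]: "u \<in> borel_measurable M" "v \<in> borel_measurable M"
    and nn: "\<And>x. 0 \<le> u x" "\<And>x. 0 \<le> v x" and ab: "0 < a" "0 < b"
    and u: "integrable M (\<lambda>x. u x powr p)" "(\<integral>x. u x powr p \<partial>M) \<le> a powr p"
    and v: "integrable M (\<lambda>x. v x powr p)" "(\<integral>x. v x powr p \<partial>M) \<le> b powr p"
  shows "integrable M (\<lambda>x. (u x + v x) powr p)"
    and "(\<integral>x. (u x + v x) powr p \<partial>M) \<le> (a + b) powr p"
proof -
  define c where "c = (a + b) powr p"
  define s t where "s = a / (a + b)" and "t = b / (a + b)"
  have st: "0 \<le> s" "0 \<le> t" "s + t = 1" "0 \<le> c"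
    using ab by (auto simp: s_def t_def c_def field_simps add_divide_distrib[symmetric])
  let ?B = "\<lambda>x. c * (s * (u x powr p / a powr p) + t * (v x powr p / b powr p))"
  have le: "(u x + v x) powr p \<le> ?B x" for x
  proof -
    have "s * (u x / a) = u x / (a + b)" "t * (v x / b) = v x / (a + b)"
      using ab by (simp_all add: s_def t_def)
    then have "u x + v x = (a + b) * (s * (u x / a) + t * (v x / b))"
      using ab by (simp add: add_divide_distrib[symmetric])
    then have "(u x + v x) powr p = c * (s * (u x / a) + t * (v x / b)) powr p"
      using ab nn st unfolding c_def by (simp add: powr_mult)
    also have "\<dots> \<le> c * (s * (u x / a) powr p + t * (v x / b) powr p)"
      using ab nn st by (intro mult_left_mono convex_powr_nonneg p) auto
    finally show ?thesis using nn ab by (simp add: powr_divide)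
  qed
  have B: "integrable M ?B" using u(1) v(1) by auto
  show i: "integrable M (\<lambda>x. (u x + v x) powr p)"
    by (rule Bochner_Integration.integrable_bound[OF B]) (use le in \<open>auto intro: order_trans[OF _ abs_ge_self]\<close>)
  have "(\<integral>x. (u x + v x) powr p \<partial>M) \<le> (\<integral>x. ?B x \<partial>M)"
    using i B le by (rule integral_mono)
  also have "\<dots> = c * (s * ((\<integral>x. u x powr p \<partial>M) / a powr p) + t * ((\<integral>x. v x powr p \<partial>M) / b powr p))"
    using u(1) v(1) by simp
  also have "\<dots> \<le> c * (s * 1 + t * 1)"
    using u(2) v(2) ab st by (intro mult_left_mono add_mono) (auto simp: divide_le_eq)
  finally show "(\<integral>x. (u x + v x) powr p \<partial>M) \<le> (a + b) powr p"
    using st by (simp add: c_def)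
qed

section \<open>Gluing transport plans\<close>

lemma couplingsD:
  assumes "\<gamma> \<in> couplings \<mu> \<nu>"
  shows "prob_space \<gamma>" "sets \<gamma> = sets borel" "distr \<gamma> borel fst = \<mu>" "distr \<gamma> borel snd = \<nu>"
    "space \<gamma> = UNIV"
  using assms sets_eq_imp_space_eq[of \<gamma> borel] by (auto simp: couplings_def)

lemma borel_measurable_fst_snd [measurable]:
  "fst \<in> borel_measurable (borel :: ('a::second_countable_topology \<times> 'b::second_countable_topology) measure)"
  "snd \<in> borel_measurable (borel :: ('a \<times> 'b) measure)"
  by (intro borel_measurable_continuous_onI continuous_intros)+

text \<open>The index of \<open>y\<close> is that of the first point of an enumerated dense set
  within \<open>e / 2\<close> of \<open>y\<close>; two points sharing it are less than
  \<open>e\<close> apart.\<close>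

lemma ex_fine_countable_index:
  fixes e :: real
  assumes "0 < e"
  shows "\<exists>N :: 'a::euclidean_space \<Rightarrow> nat. N \<in> measurable borel (count_space UNIV) \<and>
           (\<forall>x y. N x = N y \<longrightarrow> norm (x - y) < e)"
proof -
  obtain D :: "'a set" where D: "countable D" "\<And>X. open X \<Longrightarrow> X \<noteq> {} \<Longrightarrow> \<exists>d\<in>D. d \<in> X"
    using countable_dense_exists by blast
  have "D \<noteq> {}" using D(2)[of UNIV] by auto
  define X where "X = from_nat_into D"
  define N where "N y = (LEAST n. dist y (X n) < e / 2)" for y
  have ex: "\<exists>n. dist y (X n) < e / 2" for y
  proof -
    obtain d where "d \<in> D" "d \<in> ball y (e / 2)"
      using D(2)[of "ball y (e / 2)"] \<open>0 < e\<close> by auto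
    then show ?thesis
      unfolding X_def using from_nat_into_surj[OF D(1), of d] by auto
  qed
  have N: "dist y (X (N y)) < e / 2" for y
    unfolding N_def using ex by (rule LeastI_ex)
  show ?thesis
  proof (intro exI[of _ N] conjI allI impI)
    show "N \<in> measurable borel (count_space UNIV)"
      unfolding N_def by measurable
    show "norm (x - y) < e" if "N x = N y" for x y
      using N[of x] N[of y] that dist_triangle_half_l[of x "X (N x)" e y]
      by (simp add: dist_norm norm_minus_commute)
  qed
qed

lemma borel_measurable_glued_density:
  fixes R :: "nat \<Rightarrow> ennreal"
  assumes [measurable]: "U \<in> measurable \<alpha> (count_space UNIV)" "V \<in> measurable \<beta> (count_space UNIV)"
  shows "(\<lambda>w. if U (fst w) = V (snd w) then 1 / R (U (fst w)) else 0) \<in> borel_measurable (\<alpha> \<Otimes>\<^sub>M \<beta>)"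
proof -
  have "(\<lambda>n. 1 / R n) \<in> borel_measurable (count_space UNIV)" by simp
  from measurable_compose[OF measurable_compose[OF measurable_fst assms(1)] this]
  have "(\<lambda>w. 1 / R (U (fst w))) \<in> borel_measurable (\<alpha> \<Otimes>\<^sub>M \<beta>)" .
  \<comment> \<open>Coincidence of the indices is written as a countable union of measurable
    rectangles.\<close>
  moreover have "Measurable.pred (\<alpha> \<Otimes>\<^sub>M \<beta>) (\<lambda>w. \<exists>n. U (fst w) = n \<and> V (snd w) = n)"
    by measurable
  ultimately show ?thesis by (intro measurable_If) (auto simp: pred_def eq_commute)
qed

text \<open>Gluing without disintegration: the product of the two plans, conditioned on the middle
  coordinates lying in the same small cell.\<close>

lemma nn_integral_glued_density:
  fixes \<alpha> :: "'a measure" and \<beta> :: "'b measure" and \<rho> :: "nat measure"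
  assumes "prob_space \<alpha>" "prob_space \<beta>"
    and [measurable]: "U \<in> measurable \<alpha> (count_space UNIV)" "V \<in> measurable \<beta> (count_space UNIV)"
    and \<rho>: "distr \<alpha> (count_space UNIV) U = \<rho>" "distr \<beta> (count_space UNIV) V = \<rho>"
    and [measurable]: "f \<in> borel_measurable \<alpha>"
  shows "(\<integral>\<^sup>+w. (if U (fst w) = V (snd w) then 1 / emeasure \<rho> {U (fst w)} else 0) * f (fst w) \<partial>(\<alpha> \<Otimes>\<^sub>M \<beta>))
     = (\<integral>\<^sup>+x. f x \<partial>\<alpha>)"
proof -
  interpret A: prob_space \<alpha> by fact
  interpret B: prob_space \<beta> by fact
  interpret pair_sigma_finite \<alpha> \<beta> ..
  define r where "r n = emeasure \<rho> {n}" for n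
  have [measurable]: "(\<lambda>w. if U (fst w) = V (snd w) then 1 / r (U (fst w)) else 0)
      \<in> borel_measurable (\<alpha> \<Otimes>\<^sub>M \<beta>)"
    by (rule borel_measurable_glued_density) measurable
  have "(\<lambda>y. if U x = V y then 1 / r (U x) else 0) \<in> borel_measurable \<beta>" for x
    by measurable
  note [measurable] = this
  have rU: "r n = emeasure \<alpha> (U -` {n} \<inter> space \<alpha>)" for n
    unfolding r_def \<rho>(1)[symmetric] by (simp add: emeasure_distr)
  have rV: "r n = emeasure \<beta> (V -` {n} \<inter> space \<beta>)" for n
    unfolding r_def \<rho>(2)[symmetric] by (simp add: emeasure_distr)
  \<comment> \<open>On a cell of mass 0 the factor \<open>1 / r\<close> would be infinite; there are
    countably many cells, so such cells together are hit with probability 0.\<close>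
  have "AE x in \<alpha>. r (U x) \<noteq> 0"
  proof -
    have "AE x in \<alpha>. r n = 0 \<longrightarrow> U x \<noteq> n" for n
    proof (cases "r n = 0")
      case True
      then show ?thesis
        by (intro AE_I'[of "U -` {n} \<inter> space \<alpha>"]) (auto simp: null_sets_def rU)
    qed simp
    then have "AE x in \<alpha>. \<forall>n. r n = 0 \<longrightarrow> U x \<noteq> n" by (simp add: AE_all_countable)
    then show ?thesis by eventually_elim auto
  qed
  \<comment> \<open>For fixed \<open>x\<close> the density is constant on the matching cell and 0
    elsewhere, so the mass of the cell cancels. Since \<open>f\<close> depends on the first
    coordinate alone, Fubini then gives the claim.\<close>
  then have one: "AE x in \<alpha>. (\<integral>\<^sup>+y. (if U x = V y then 1 / r (U x) else 0) \<partial>\<beta>) = 1"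
  proof eventually_elim
    case (elim x)
    have "r (U x) \<noteq> \<top>" unfolding rV using B.emeasure_finite by (simp add: less_top)
    have "(\<integral>\<^sup>+y. (if U x = V y then 1 / r (U x) else 0) \<partial>\<beta>)
        = (\<integral>\<^sup>+y. (1 / r (U x)) * indicator (V -` {U x} \<inter> space \<beta>) y \<partial>\<beta>)"
      by (intro nn_integral_cong) (auto simp: indicator_def)
    also have "\<dots> = 1 / r (U x) * r (U x)"
      by (subst nn_integral_cmult_indicator) (auto simp: rV)
    also have "\<dots> = 1"
      using elim \<open>r (U x) \<noteq> \<top>\<close>
      by (simp add: ennreal_divide_times ennreal_divide_self less_top[symmetric])
    finally show ?case .
  qed
  have "(\<integral>\<^sup>+w. (if U (fst w) = V (snd w) then 1 / r (U (fst w)) else 0) * f (fst w) \<partial>(\<alpha> \<Otimes>\<^sub>M \<beta>))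
      = (\<integral>\<^sup>+x. \<integral>\<^sup>+y. (if U x = V y then 1 / r (U x) else 0) * f x \<partial>\<beta> \<partial>\<alpha>)"
    by (subst B.nn_integral_fst[symmetric], measurable) (simp only: fst_conv snd_conv)
  also have "\<dots> = (\<integral>\<^sup>+x. (\<integral>\<^sup>+y. (if U x = V y then 1 / r (U x) else 0) \<partial>\<beta>) * f x \<partial>\<alpha>)"
    by (intro nn_integral_cong nn_integral_multc) auto
  also have "\<dots> = (\<integral>\<^sup>+x. f x \<partial>\<alpha>)"
    using one by (intro nn_integral_cong_AE) auto
  finally show ?thesis unfolding r_def .
qed

text \<open>Both plans have \<open>\<nu>\<close> as middle marginal, so the cell indices of their
  middle coordinates have the same law \<open>\<rho>\<close>. The density \<open>r\<close> therefore
  preserves both plans as marginals, while the middle coordinates agree up to \<open>e\<close>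
  instead of exactly.\<close>

lemma glue_couplings:
  fixes \<mu> \<nu> \<sigma> :: "'a::euclidean_space measure"
  assumes g1: "\<gamma>\<^sub>1 \<in> couplings \<mu> \<nu>" and g2: "\<gamma>\<^sub>2 \<in> couplings \<nu> \<sigma>" and "0 < e"
  obtains M :: "(('a \<times> 'a) \<times> 'a \<times> 'a) measure" where
    "prob_space M" "sets M = sets borel" "distr M borel fst = \<gamma>\<^sub>1" "distr M borel snd = \<gamma>\<^sub>2"
    "AE w in M. norm (snd (fst w) - fst (snd w)) < e"
proof -
  note c1 = couplingsD[OF g1] and c2 = couplingsD[OF g2]
  note [measurable_cong] = c1(2) c2(2)
  obtain N :: "'a \<Rightarrow> nat" where [measurable]: "N \<in> measurable borel (count_space UNIV)"
    and N: "\<And>x y. N x = N y \<Longrightarrow> norm (x - y) < e"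
    using ex_fine_countable_index[OF \<open>0 < e\<close>] by blast
  interpret G1: prob_space \<gamma>\<^sub>1 by fact
  interpret G2: prob_space \<gamma>\<^sub>2 by fact
  interpret P: pair_sigma_finite \<gamma>\<^sub>2 \<gamma>\<^sub>1 ..
  define \<rho> where "\<rho> = distr \<nu> (count_space UNIV) N"
  define U V where "U = (\<lambda>z :: 'a \<times> 'a. N (snd z))" and "V = (\<lambda>z :: 'a \<times> 'a. N (fst z))"
  have U[measurable]: "U \<in> measurable borel (count_space UNIV)"
    and V[measurable]: "V \<in> measurable borel (count_space UNIV)"
    unfolding U_def V_def by measurable
  have \<rho>: "distr \<gamma>\<^sub>1 (count_space UNIV) U = \<rho>" "distr \<gamma>\<^sub>2 (count_space UNIV) V = \<rho>"
  proof -
    show "distr \<gamma>\<^sub>1 (count_space UNIV) U = \<rho>"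
      unfolding \<rho>_def c1(4)[symmetric] by (subst distr_distr) (auto simp: U_def comp_def)
    show "distr \<gamma>\<^sub>2 (count_space UNIV) V = \<rho>"
      unfolding \<rho>_def c2(3)[symmetric] by (subst distr_distr) (auto simp: V_def comp_def)
  qed
  define r where "r w = (if U (fst w) = V (snd w) then 1 / emeasure \<rho> {U (fst w)} else 0)" for w
  have [measurable]: "r \<in> borel_measurable (\<gamma>\<^sub>1 \<Otimes>\<^sub>M \<gamma>\<^sub>2)"
    unfolding r_def by (rule borel_measurable_glued_density) measurable
  define M where "M = density (\<gamma>\<^sub>1 \<Otimes>\<^sub>M \<gamma>\<^sub>2) r"
  have sP: "sets (\<gamma>\<^sub>1 \<Otimes>\<^sub>M \<gamma>\<^sub>2) = sets borel"
    using sets_pair_measure_cong[OF c1(2) c2(2)] by (simp only: borel_prod)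
  then have sM[measurable_cong]: "sets M = sets borel" by (simp add: M_def)
  have d1: "distr M borel fst = \<gamma>\<^sub>1"
  proof (rule measure_eqI)
    fix A assume "A \<in> sets (distr M borel fst)"
    then have [measurable]: "A \<in> sets borel" by simp
    have "emeasure (distr M borel fst) A = (\<integral>\<^sup>+w. indicator A (fst w) \<partial>M)"
      by (simp add: nn_integral_distr flip: nn_integral_indicator)
    also have "\<dots> = (\<integral>\<^sup>+w. r w * indicator A (fst w) \<partial>(\<gamma>\<^sub>1 \<Otimes>\<^sub>M \<gamma>\<^sub>2))"
      unfolding M_def by (subst nn_integral_density) auto
    also have "\<dots> = (\<integral>\<^sup>+z. indicator A z \<partial>\<gamma>\<^sub>1)"
      unfolding r_def by (rule nn_integral_glued_density[OF c1(1) c2(1) _ _ \<rho>]) measurable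
    also have "\<dots> = emeasure \<gamma>\<^sub>1 A" by simp
    finally show "emeasure (distr M borel fst) A = emeasure \<gamma>\<^sub>1 A" .
  qed (simp add: c1(2))
  have d2: "distr M borel snd = \<gamma>\<^sub>2"
  proof (rule measure_eqI)
    fix A assume "A \<in> sets (distr M borel snd)"
    then have [measurable]: "A \<in> sets borel" by simp
    have "emeasure (distr M borel snd) A = (\<integral>\<^sup>+w. indicator A (snd w) \<partial>M)"
      by (simp add: nn_integral_distr flip: nn_integral_indicator)
    also have "\<dots> = (\<integral>\<^sup>+w. r w * indicator A (snd w) \<partial>(\<gamma>\<^sub>1 \<Otimes>\<^sub>M \<gamma>\<^sub>2))"
      unfolding M_def by (subst nn_integral_density) auto
    \<comment> \<open>Exchanging the factors reduces this marginal to the same lemma: where the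
      indices coincide, the normalising mass can be read off from either of them.\<close>
    also have "\<dots> = (\<integral>\<^sup>+w. r (snd w, fst w) * indicator A (fst w) \<partial>(\<gamma>\<^sub>2 \<Otimes>\<^sub>M \<gamma>\<^sub>1))"
      by (subst P.distr_pair_swap, subst nn_integral_distr) (auto simp: split_beta)
    also have "\<dots> = (\<integral>\<^sup>+w. (if V (fst w) = U (snd w) then 1 / emeasure \<rho> {V (fst w)} else 0)
                          * indicator A (fst w) \<partial>(\<gamma>\<^sub>2 \<Otimes>\<^sub>M \<gamma>\<^sub>1))"
      by (intro nn_integral_cong) (auto simp: r_def)
    also have "\<dots> = (\<integral>\<^sup>+z. indicator A z \<partial>\<gamma>\<^sub>2)"
      by (rule nn_integral_glued_density[OF c2(1) c1(1) _ _ \<rho>(2,1)]) measurable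
    also have "\<dots> = emeasure \<gamma>\<^sub>2 A" by simp
    finally show "emeasure (distr M borel snd) A = emeasure \<gamma>\<^sub>2 A" .
  qed (simp add: c2(2))
  have "prob_space M"
  proof (rule prob_space_distrD[of fst M borel])
    show "prob_space (distr M borel fst)" unfolding d1 by fact
  qed measurable
  moreover have "AE w in M. norm (snd (fst w) - fst (snd w)) < e"
    unfolding M_def by (subst AE_density) (auto simp: r_def U_def V_def intro: N)
  ultimately show ?thesis using that sM d1 d2 by blast
qed

lemma transport_cost_distr:
  assumes [measurable]: "f \<in> borel_measurable M" "g \<in> borel_measurable M"
  shows "transport_cost p (distr M borel (\<lambda>w. (f w, g w))) = (\<integral>w. norm (f w - g w) powr p \<partial>M)"
  unfolding transport_cost_def by (subst integral_distr) auto

lemma coupling_distr: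
  assumes "prob_space M" and [measurable]: "f \<in> borel_measurable M" "g \<in> borel_measurable M"
    and "distr M borel f = \<mu>" "distr M borel g = \<nu>"
  shows "distr M borel (\<lambda>w. (f w, g w)) \<in> couplings \<mu> \<nu>"
  using assms(1,4,5) prob_space.prob_space_distr[OF assms(1), of "\<lambda>w. (f w, g w)" borel]
  by (auto simp: couplings_def distr_distr comp_def)

text \<open>Under the glued measure, the outer points are joined by three legs: one along each plan
  and a gap shorter than \<open>e\<close> between the middle points. Minkowski is applied first to
  the first leg and the gap, then to the result and the last leg.\<close>

lemma couplings_triangle:
  fixes \<mu> \<nu> \<sigma> :: "'a::euclidean_space measure"
  assumes p: "1 \<le> p" and W: "\<mu> \<in> wasserstein_space p" "\<nu> \<in> wasserstein_space p" "\<sigma> \<in> wasserstein_space p"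
    and g: "\<gamma>\<^sub>1 \<in> couplings \<mu> \<nu>" "\<gamma>\<^sub>2 \<in> couplings \<nu> \<sigma>" and ab: "0 < a" "0 < b" "0 < e"
    and le: "transport_cost p \<gamma>\<^sub>1 \<le> a powr p" "transport_cost p \<gamma>\<^sub>2 \<le> b powr p"
  shows "\<exists>\<gamma>\<in>couplings \<mu> \<sigma>. transport_cost p \<gamma> \<le> (a + e + b) powr p"
proof -
  obtain M :: "(('a \<times> 'a) \<times> 'a \<times> 'a) measure" where M: "prob_space M"
    and sM[measurable_cong]: "sets M = sets borel"
    and d: "distr M borel fst = \<gamma>\<^sub>1" "distr M borel snd = \<gamma>\<^sub>2"
    and e: "AE w in M. norm (snd (fst w) - fst (snd w)) < e"
    using glue_couplings[OF g ab(3)] by blast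
  interpret prob_space M by fact
  let ?u = "\<lambda>w. norm (fst (fst w) - snd (fst w))" and ?v = "\<lambda>w. norm (snd (fst w) - fst (snd w))"
    and ?x = "\<lambda>w. norm (fst (snd w) - snd (snd w))"
  have u: "integrable M (\<lambda>w. ?u w powr p)" "(\<integral>w. ?u w powr p \<partial>M) \<le> a powr p"
    using transport_cost_integrable[OF p W(1,2) g(1)] le(1) unfolding transport_cost_def d(1)[symmetric]
    by (simp_all add: integrable_distr_eq integral_distr)
  have x: "integrable M (\<lambda>w. ?x w powr p)" "(\<integral>w. ?x w powr p \<partial>M) \<le> b powr p"
    using transport_cost_integrable[OF p W(2,3) g(2)] le(2) unfolding transport_cost_def d(2)[symmetric]
    by (simp_all add: integrable_distr_eq integral_distr)
  have ve: "AE w in M. ?v w powr p \<le> e powr p"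
    using e by eventually_elim (use p in \<open>auto intro: powr_mono2\<close>)
  have v: "integrable M (\<lambda>w. ?v w powr p)"
    by (rule integrable_const_bound[of _ "e powr p"]) (use ve in auto)
  have "(\<integral>w. ?v w powr p \<partial>M) \<le> (\<integral>w. e powr p \<partial>M)"
    using v ve by (intro integral_mono_AE) auto
  then have v': "(\<integral>w. ?v w powr p \<partial>M) \<le> e powr p" by (simp add: prob_space)
  note uv = integral_powr_add_le[OF p _ _ _ _ ab(1,3) u v v']
  have uvx: "integrable M (\<lambda>w. (?u w + ?v w + ?x w) powr p)"
    "(\<integral>w. (?u w + ?v w + ?x w) powr p \<partial>M) \<le> (a + e + b) powr p"
    using integral_powr_add_le[OF p _ _ _ _ _ ab(2) uv x] ab by simp_all
  let ?f = "\<lambda>w :: ('a \<times> 'a) \<times> 'a \<times> 'a. fst (fst w)" and ?g = "\<lambda>w :: ('a \<times> 'a) \<times> 'a \<times> 'a. snd (snd w)"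
  have le: "norm (?f w - ?g w) powr p \<le> (?u w + ?v w + ?x w) powr p" for w
  proof -
    have "norm (?f w - ?g w) \<le> ?u w + ?v w + ?x w"
      using norm_triangle_ineq[of "?f w - snd (fst w)" "snd (fst w) - ?g w"]
        norm_triangle_ineq[of "snd (fst w) - fst (snd w)" "fst (snd w) - ?g w"] by simp
    then show ?thesis using p by (intro powr_mono2) auto
  qed
  have "(\<integral>w. norm (?f w - ?g w) powr p \<partial>M) \<le> (\<integral>w. (?u w + ?v w + ?x w) powr p \<partial>M)"
    using uvx(1) le by (intro integral_mono_AE') auto
  then have c: "transport_cost p (distr M borel (\<lambda>w. (?f w, ?g w))) \<le> (a + e + b) powr p"
    using uvx(2) by (subst transport_cost_distr) auto
  have "distr M borel ?f = \<mu>" "distr M borel ?g = \<sigma>"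
    unfolding couplingsD(3)[OF g(1), symmetric] couplingsD(4)[OF g(2), symmetric] d[symmetric]
    by (simp_all add: distr_distr comp_def)
  then have "distr M borel (\<lambda>w. (?f w, ?g w)) \<in> couplings \<mu> \<sigma>"
    using M by (intro coupling_distr) auto
  with c show ?thesis by blast
qed

section \<open>The metric properties of the Wasserstein distance\<close>

lemma transport_cost_nonneg: "0 \<le> transport_cost p \<gamma>"
  unfolding transport_cost_def by simp

lemma wasserstein_nonneg: "0 \<le> wasserstein p \<mu> \<nu>"
  unfolding wasserstein_def by simp

lemma wasserstein_optimal_plan:
  assumes "optimal_plan p \<mu> \<nu> \<gamma>"
  shows "wasserstein p \<mu> \<nu> = transport_cost p \<gamma> powr (1 / p)"
proof -
  have "(INF \<gamma>\<in>couplings \<mu> \<nu>. transport_cost p \<gamma>) = transport_cost p \<gamma>"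
    using assms by (intro cInf_eq_minimum) (auto simp: optimal_plan_def)
  then show ?thesis by (simp add: wasserstein_def)
qed

lemma wasserstein_le:
  assumes "1 \<le> p" "\<gamma> \<in> couplings \<mu> \<nu>" "0 \<le> a" "transport_cost p \<gamma> \<le> a powr p"
  shows "wasserstein p \<mu> \<nu> \<le> a"
proof -
  have "(INF \<gamma>\<in>couplings \<mu> \<nu>. transport_cost p \<gamma>) \<le> transport_cost p \<gamma>"
    using assms(2) by (intro cINF_lower bdd_belowI[of _ 0]) (auto simp: transport_cost_nonneg)
  moreover have "0 \<le> (INF \<gamma>\<in>couplings \<mu> \<nu>. transport_cost p \<gamma>)"
    using assms(2) by (intro cINF_greatest) (auto simp: transport_cost_nonneg)
  ultimately have "wasserstein p \<mu> \<nu> \<le> (a powr p) powr (1 / p)"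
    unfolding wasserstein_def using assms by (intro powr_mono2) auto
  also have "\<dots> = a" using assms by (simp add: powr_powr)
  finally show ?thesis .
qed

lemma transport_cost_optimal_plan:
  assumes "1 \<le> p" "optimal_plan p \<mu> \<nu> \<gamma>"
  shows "transport_cost p \<gamma> = wasserstein p \<mu> \<nu> powr p"
  unfolding wasserstein_optimal_plan[OF assms(2)] using assms(1) transport_cost_nonneg[of p \<gamma>]
  by (simp add: powr_powr)

lemma wasserstein_refl:
  fixes \<mu> :: "'a::euclidean_space measure"
  assumes "1 \<le> p" "\<mu> \<in> wasserstein_space p"
  shows "wasserstein p \<mu> \<mu> = 0"
proof -
  have "prob_space \<mu>" and [measurable_cong]: "sets \<mu> = sets borel"
    using assms(2) by (auto simp: wasserstein_space_def)
  moreover from this have "distr \<mu> borel (\<lambda>x. x) = \<mu>" by (intro distr_id2) simp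
  \<comment> \<open>The diagonal coupling has cost 0.\<close>
  ultimately have "distr \<mu> borel (\<lambda>x. (x, x)) \<in> couplings \<mu> \<mu>"
    by (intro coupling_distr) auto
  then have "wasserstein p \<mu> \<mu> \<le> 0"
    by (rule wasserstein_le[OF assms(1)]) (auto simp: transport_cost_distr)
  then show ?thesis using wasserstein_nonneg[of p \<mu> \<mu>] by simp
qed

text \<open>Exchanging the coordinates of an optimal plan yields a coupling in the opposite
  direction with the same cost.\<close>

lemma wasserstein_commute_le:
  assumes "1 \<le> p" "optimal_plan p \<mu> \<nu> \<gamma>"
  shows "wasserstein p \<nu> \<mu> \<le> wasserstein p \<mu> \<nu>"
proof -
  have "\<gamma> \<in> couplings \<mu> \<nu>" using assms(2) by (simp add: optimal_plan_def)
  note c = couplingsD[OF this] and [measurable_cong] = couplingsD(2)[OF this]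
  show ?thesis
  proof (rule wasserstein_le[OF assms(1)])
    show "distr \<gamma> borel (\<lambda>z. (snd z, fst z)) \<in> couplings \<nu> \<mu>"
      using c by (intro coupling_distr) auto
    show "transport_cost p (distr \<gamma> borel (\<lambda>z. (snd z, fst z))) \<le> wasserstein p \<mu> \<nu> powr p"
      unfolding transport_cost_optimal_plan[OF assms, symmetric]
      by (subst transport_cost_distr) (auto simp: transport_cost_def norm_minus_commute)
  qed (rule wasserstein_nonneg)
qed

lemma wasserstein_commute:
  fixes \<mu> \<nu> :: "'a::euclidean_space measure"
    and G :: "'a measure \<Rightarrow> 'a measure \<Rightarrow> ('a \<times> 'a) measure"
  assumes "1 \<le> p" "optimal_plan_choice p G" "\<mu> \<in> wasserstein_space p" "\<nu> \<in> wasserstein_space p"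
  shows "wasserstein p \<mu> \<nu> = wasserstein p \<nu> \<mu>"
  using wasserstein_commute_le[OF assms(1), of \<mu> \<nu> "G \<mu> \<nu>"]
    wasserstein_commute_le[OF assms(1), of \<nu> \<mu> "G \<nu> \<mu>"] assms(2-4)
  by (simp add: optimal_plan_choice_def)

lemma wasserstein_triangle:
  fixes \<mu> \<nu> \<sigma> :: "'a::euclidean_space measure"
    and G :: "'a measure \<Rightarrow> 'a measure \<Rightarrow> ('a \<times> 'a) measure"
  assumes p: "1 \<le> p" and G: "optimal_plan_choice p G"
    and W: "\<mu> \<in> wasserstein_space p" "\<nu> \<in> wasserstein_space p" "\<sigma> \<in> wasserstein_space p"
  shows "wasserstein p \<mu> \<sigma> \<le> wasserstein p \<mu> \<nu> + wasserstein p \<nu> \<sigma>"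
proof (rule field_le_epsilon)
  fix e :: real assume "0 < e"
  \<comment> \<open>Two thirds of the slack keep \<open>a\<close> and \<open>b\<close> positive even
    when a distance is 0; the last third pays for the gap in the glued plan.\<close>
  define a b where "a = wasserstein p \<mu> \<nu> + e / 3" and "b = wasserstein p \<nu> \<sigma> + e / 3"
  have ab: "0 < a" "0 < b" "0 < e / 3"
    using \<open>0 < e\<close> wasserstein_nonneg[of p \<mu> \<nu>] wasserstein_nonneg[of p \<nu> \<sigma>] by (auto simp: a_def b_def)
  have o: "optimal_plan p \<mu> \<nu> (G \<mu> \<nu>)" "optimal_plan p \<nu> \<sigma> (G \<nu> \<sigma>)"
    using G W by (auto simp: optimal_plan_choice_def)
  have le: "transport_cost p (G \<mu> \<nu>) \<le> a powr p" "transport_cost p (G \<nu> \<sigma>) \<le> b powr p"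
    unfolding o[THEN transport_cost_optimal_plan[OF p]] a_def b_def
    using \<open>0 < e\<close> p wasserstein_nonneg by (auto intro!: powr_mono2)
  obtain \<gamma> where "\<gamma> \<in> couplings \<mu> \<sigma>" "transport_cost p \<gamma> \<le> (a + e / 3 + b) powr p"
    using couplings_triangle[OF p W _ _ ab le] o by (auto simp: optimal_plan_def)
  then have "wasserstein p \<mu> \<sigma> \<le> a + e / 3 + b"
    using ab by (intro wasserstein_le[OF p]) auto
  then show "wasserstein p \<mu> \<sigma> \<le> wasserstein p \<mu> \<nu> + wasserstein p \<nu> \<sigma> + e"
    by (simp add: a_def b_def)
qed

section \<open>McCann averages\<close>

text \<open>The \<open>p\<close>-th moment stays finite because the \<open>p\<close>-th power of the
  norm is convex along segments, so it is controlled by the moments of the endpoints.\<close>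

lemma mccann_in_wasserstein_space:
  fixes \<mu> \<nu> :: "'a::euclidean_space measure"
  assumes p: "1 \<le> p" and G: "optimal_plan p \<mu> \<nu> (G \<mu> \<nu>)"
    and W: "\<mu> \<in> wasserstein_space p" "\<nu> \<in> wasserstein_space p" and t: "0 \<le> t" "t \<le> 1"
  shows "mccann G \<mu> \<nu> t \<in> wasserstein_space p"
proof -
  have "G \<mu> \<nu> \<in> couplings \<mu> \<nu>" using G by (simp add: optimal_plan_def)
  note c = couplingsD[OF this] and [measurable_cong] = couplingsD(2)[OF this]
  interpret prob_space "G \<mu> \<nu>" by (rule c(1))
  let ?f = "\<lambda>z :: 'a \<times> 'a. (1 - t) *\<^sub>R fst z + t *\<^sub>R snd z"
  have m: "mccann G \<mu> \<nu> t = distr (G \<mu> \<nu>) borel ?f"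
    by (simp add: mccann_def case_prod_unfold)
  have "integrable (distr (G \<mu> \<nu>) borel fst) (\<lambda>x. norm x powr p)"
    "integrable (distr (G \<mu> \<nu>) borel snd) (\<lambda>x. norm x powr p)"
    using W by (simp_all only: c(3,4)) (simp_all add: wasserstein_space_def)
  then have i: "integrable (G \<mu> \<nu>) (\<lambda>z. norm (fst z) powr p)"
    "integrable (G \<mu> \<nu>) (\<lambda>z. norm (snd z) powr p)"
    by (simp_all add: integrable_distr_eq)
  have le: "norm (?f z) powr p \<le> (1 - t) * norm (fst z) powr p + t * norm (snd z) powr p" for z
  proof -
    have "norm (?f z) \<le> (1 - t) * norm (fst z) + t * norm (snd z)"
      using norm_triangle_ineq[of "(1 - t) *\<^sub>R fst z" "t *\<^sub>R snd z"] t by simp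
    then have "norm (?f z) powr p \<le> ((1 - t) * norm (fst z) + t * norm (snd z)) powr p"
      using p by (intro powr_mono2) auto
    also have "\<dots> \<le> (1 - t) * norm (fst z) powr p + t * norm (snd z) powr p"
      using p t by (intro convex_powr_nonneg) auto
    finally show ?thesis .
  qed
  have "integrable (G \<mu> \<nu>) (\<lambda>z. norm (?f z) powr p)"
  proof (rule Bochner_Integration.integrable_bound)
    show "integrable (G \<mu> \<nu>) (\<lambda>z. (1 - t) * norm (fst z) powr p + t * norm (snd z) powr p)"
      using i by simp
    show "AE z in G \<mu> \<nu>. norm (norm (?f z) powr p) \<le> norm ((1 - t) * norm (fst z) powr p + t * norm (snd z) powr p)"
      using order_trans[OF le abs_ge_self] by simp
  qed measurable
  then show ?thesis
    unfolding m wasserstein_space_def by (auto simp: integrable_distr_eq intro!: prob_space_distr)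
qed

text \<open>Each starting point is coupled with its position at time \<open>t\<close> on the segment
  prescribed by the plan; every displacement is thereby scaled by \<open>t\<close>.\<close>

lemma wasserstein_mccann_le:
  fixes \<mu> \<nu> :: "'a::euclidean_space measure"
  assumes p: "1 \<le> p" and G: "optimal_plan p \<mu> \<nu> (G \<mu> \<nu>)" and t: "0 \<le> t"
  shows "wasserstein p \<mu> (mccann G \<mu> \<nu> t) \<le> t * wasserstein p \<mu> \<nu>"
proof -
  have "G \<mu> \<nu> \<in> couplings \<mu> \<nu>" using G by (simp add: optimal_plan_def)
  note c = couplingsD[OF this] and [measurable_cong] = couplingsD(2)[OF this]
  let ?f = "\<lambda>z :: 'a \<times> 'a. (1 - t) *\<^sub>R fst z + t *\<^sub>R snd z"
  have m: "mccann G \<mu> \<nu> t = distr (G \<mu> \<nu>) borel ?f"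
    by (simp add: mccann_def case_prod_unfold)
  show ?thesis
  proof (rule wasserstein_le[OF p])
    show "distr (G \<mu> \<nu>) borel (\<lambda>z. (fst z, ?f z)) \<in> couplings \<mu> (mccann G \<mu> \<nu> t)"
      using c by (intro coupling_distr) (auto simp: m)
    have eq: "fst z - ?f z = t *\<^sub>R (fst z - snd z)" for z :: "'a \<times> 'a"
      by (simp add: algebra_simps)
    have "transport_cost p (distr (G \<mu> \<nu>) borel (\<lambda>z. (fst z, ?f z)))
        = (\<integral>z. norm (t *\<^sub>R (fst z - snd z)) powr p \<partial>(G \<mu> \<nu>))"
      unfolding eq[symmetric] by (subst transport_cost_distr) auto
    also have "\<dots> = t powr p * transport_cost p (G \<mu> \<nu>)"
      using t by (simp add: transport_cost_def powr_mult)
    also have "\<dots> = (t * wasserstein p \<mu> \<nu>) powr p"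
      using t by (simp add: transport_cost_optimal_plan[OF p G] powr_mult wasserstein_nonneg)
    finally show "transport_cost p (distr (G \<mu> \<nu>) borel (\<lambda>z. (fst z, ?f z))) \<le> (t * wasserstein p \<mu> \<nu>) powr p"
      by simp
  qed (use t wasserstein_nonneg[of p \<mu> \<nu>] in auto)
qed

section \<open>Sizes of the detail coefficients\<close>

text \<open>The chosen plan is the one induced by the Monge map, and it is optimal among all
  couplings by \<open>optimal_plan_choice\<close>. Hence the cost of the map is the optimal
  transport cost.\<close>

lemma ac_size_ac_minus:
  assumes "1 \<le> p" "optimal_plan_choice p G" "monge_map_choice p G T"
    and W: "\<mu> \<in> wasserstein_space p" "\<nu> \<in> wasserstein_space p" and ac: "ac_measure \<mu>" "ac_measure \<nu>"
  shows "ac_size p \<mu> (ac_minus T \<nu> \<mu>) = wasserstein p \<mu> \<nu>"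
proof -
  have G: "G \<mu> \<nu> = distr \<mu> borel (\<lambda>x. (x, T \<mu> \<nu> x))"
    and T[measurable]: "T \<mu> \<nu> \<in> borel_measurable borel"
    using assms(3) W ac unfolding monge_map_choice_def monge_map_def transport_map_def by blast+
  have o: "optimal_plan p \<mu> \<nu> (G \<mu> \<nu>)"
    using assms(2) W by (simp add: optimal_plan_choice_def)
  have [measurable_cong]: "sets \<mu> = sets borel" using W by (simp add: wasserstein_space_def)
  show ?thesis
    unfolding wasserstein_optimal_plan[OF o] G
    by (subst transport_cost_distr) (auto simp: ac_size_def ac_minus_def norm_minus_commute)
qed

text \<open>For infinite \<open>A\<close> or \<open>B\<close> the left-hand side is the junk value \<open>0\<close>.\<close>

lemma discrete_size_discrete_minus_le:
  fixes \<mu> \<nu> :: "'a::euclidean_space measure"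
  assumes "1 \<le> p" and W: "\<mu> \<in> wasserstein_space p" "\<nu> \<in> wasserstein_space p"
    and o: "optimal_plan p \<mu> \<nu> (G \<mu> \<nu>)"
  shows "discrete_size p A B (discrete_minus G \<nu> \<mu>) \<le> wasserstein p \<mu> \<nu>"
proof -
  have g: "G \<mu> \<nu> \<in> couplings \<mu> \<nu>" using o by (simp add: optimal_plan_def)
  note c = couplingsD[OF g] and [measurable_cong] = couplingsD(2)[OF g]
  interpret prob_space "G \<mu> \<nu>" by (rule c(1))
  let ?c = "\<lambda>z :: 'a \<times> 'a. norm (fst z - snd z) powr p"
  define S where "S = (\<Sum>z\<in>A \<times> B. ?c z * prob {z})"
  have S: "(\<Sum>x\<in>A. \<Sum>y\<in>B. norm (y - x) powr p * prob {(x, y)}) = S"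
    unfolding S_def by (simp add: sum.cartesian_product split_beta norm_minus_commute)
  have "S \<le> transport_cost p (G \<mu> \<nu>)"
  proof (cases "finite (A \<times> B)")
    case True
    have s: "{z} \<in> sets (G \<mu> \<nu>)" for z unfolding c(2) by simp
    have i: "integrable (G \<mu> \<nu>) (\<lambda>w. ?c z * indicator {z} w)" for z
      using s by (intro integrable_mult_right integrable_real_indicator) (auto simp: less_top[symmetric])
    \<comment> \<open>The weighted sum over the atoms is the integral of the cost restricted to the
      finite set \<open>A \<times> B\<close>, which the full cost dominates pointwise.\<close>
    have "S = (\<integral>w. (\<Sum>z\<in>A \<times> B. ?c z * indicator {z} w) \<partial>(G \<mu> \<nu>))"
      using i s by (simp add: S_def Bochner_Integration.integral_sum c(5))
    also have "\<dots> \<le> (\<integral>w. ?c w \<partial>(G \<mu> \<nu>))"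
    proof (rule integral_mono)
      show "integrable (G \<mu> \<nu>) ?c" by (rule transport_cost_integrable[OF assms(1) W g])
      show "(\<Sum>z\<in>A \<times> B. ?c z * indicator {z} w) \<le> ?c w" for w
      proof -
        have "(\<Sum>z\<in>A \<times> B. ?c z * indicator {z} w) = (\<Sum>z\<in>A \<times> B. if w = z then ?c w else 0)"
          by (intro sum.cong) (auto simp: indicator_def)
        then show ?thesis using True by simp
      qed
    qed (use i in auto)
    finally show ?thesis by (simp add: transport_cost_def)
  qed (simp add: S_def transport_cost_nonneg)
  moreover have "0 \<le> S" unfolding S_def by (intro sum_nonneg) auto
  ultimately show ?thesis
    using assms(1) unfolding wasserstein_optimal_plan[OF o]
    by (auto simp: discrete_size_def discrete_minus_def coupling_matrix_def S intro!: powr_mono2)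
qed

section \<open>Curves and the multiscale transform\<close>

lemma abs_cont_curve_lipschitz:
  fixes c :: "real \<Rightarrow> 'a::euclidean_space measure"
    and G :: "'a measure \<Rightarrow> 'a measure \<Rightarrow> ('a \<times> 'a) measure"
  assumes p: "1 \<le> p" and G: "optimal_plan_choice p G" and c: "abs_cont_curve p c"
    and fin: "max_speed p c < \<infinity>" and "s \<le> t"
  shows "wasserstein p (c s) (c t) \<le> enn2real (max_speed p c) * (t - s)"
proof -
  have W: "c t \<in> wasserstein_space p" for t using c by (simp add: abs_cont_curve_def)
  obtain g where g: "\<And>K. compact K \<Longrightarrow> set_integrable lebesgue K g"
    and le: "\<And>s t. s \<le> t \<Longrightarrow> wasserstein p (c s) (c t) \<le> (LINT r:{s..t}|lebesgue. g r)"
    using c by (auto simp: abs_cont_curve_def)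
  have gi: "g absolutely_integrable_on {a..b}" for a b using g by simp
  obtain K k where K: "primitive K k" "k \<in> borel_measurable borel" "\<And>x. 0 \<le> k x"
    "\<And>s t. s \<le> t \<Longrightarrow> integral {s..t} g \<le> K t - K s"
    using borel_primitive_majorant[OF gi] by blast
  show ?thesis
  proof (rule metric_speed_imp_lipschitz[OF _ _ K(1-3)])
    show "wasserstein p (c s) (c t) = wasserstein p (c t) (c s)" for s t
      by (rule wasserstein_commute[OF p G W W])
    show "wasserstein p (c r) (c t) \<le> wasserstein p (c r) (c s) + wasserstein p (c s) (c t)" for r s t
      by (rule wasserstein_triangle[OF p G W W W])
    show "wasserstein p (c s) (c t) \<le> K t - K s" if "s \<le> t" for s t
      using le[OF that] K(4)[OF that] set_lebesgue_integral_eq_integral(2)[OF gi, of s t] by simp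
    show "D \<le> enn2real (max_speed p c)"
      if "((\<lambda>y. wasserstein p (c (t + y)) (c t) / \<bar>y\<bar>) \<longlongrightarrow> D) (at 0)" for t D
    proof -
      have "ennreal D \<le> max_speed p c"
        unfolding max_speed_def using that by (intro SUP_upper) (auto simp: has_metric_derivative_def)
      then have "enn2real (ennreal D) \<le> enn2real (max_speed p c)"
        using fin by (intro enn2real_mono) auto
      \<comment> \<open>The embedding into \<open>ennreal\<close> truncates a negative
        \<open>D\<close>; in that case the bound holds because its right-hand side is
        nonnegative.\<close>
      then show ?thesis by (cases "0 \<le> D") (auto intro: order_trans[OF _ enn2real_nonneg])
    qed
  qed fact
qed

section \<open>Prediction error for Lipschitz samples\<close>

lemma subdivide_downsample_even:
  assumes "even i"
  shows "subdivide G (downsample m) i = m i"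
  using assms by (simp add: subdivide_def downsample_def)

lemma subdivide_downsample_odd:
  assumes "odd i"
  shows "subdivide G (downsample m) i = mccann G (m (i - 1)) (m (i + 1)) (1 / 2)"
  using assms by (auto simp: subdivide_def downsample_def add.commute elim!: oddE)

lemma subdivide_lipschitz_samples:
  fixes m :: "int \<Rightarrow> 'a::euclidean_space measure"
  assumes p: "1 \<le> p" and G: "optimal_plan_choice p G" and W: "\<And>i. m i \<in> wasserstein_space p"
    and lip: "\<And>i j. i \<le> j \<Longrightarrow> wasserstein p (m i) (m j) \<le> L * of_int (j - i)"
  shows "subdivide G (downsample m) i \<in> wasserstein_space p"
    and "wasserstein p (subdivide G (downsample m) i) (m i) \<le> 2 * L"
proof -
  have o: "optimal_plan p (m i) (m j) (G (m i) (m j))" for i j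
    using G W by (simp add: optimal_plan_choice_def)
  have L: "0 \<le> L" using lip[of 0 1] wasserstein_nonneg[of p "m 0" "m 1"] by simp
  let ?a = "mccann G (m (i - 1)) (m (i + 1)) (1 / 2)"
  have a: "?a \<in> wasserstein_space p" by (rule mccann_in_wasserstein_space[where G=G, OF p o[of "i - 1" "i + 1"] W W]) auto
  show "subdivide G (downsample m) i \<in> wasserstein_space p"
    using a W by (cases "even i") (simp_all add: subdivide_downsample_even subdivide_downsample_odd)
  show "wasserstein p (subdivide G (downsample m) i) (m i) \<le> 2 * L"
  proof (cases "even i")
    case True
    then show ?thesis using L by (simp add: subdivide_downsample_even wasserstein_refl[OF p W])
  next
    case False
    \<comment> \<open>The route goes through the left neighbour. The two neighbours are two fine
      steps apart, so half their distance contributes \<open>L\<close>, and the step from the left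
      neighbour to \<open>m i\<close> contributes another \<open>L\<close>.\<close>
    have "wasserstein p ?a (m i) \<le> wasserstein p (m (i - 1)) ?a + wasserstein p (m (i - 1)) (m i)"
      using wasserstein_triangle[OF p G a W[of "i - 1"] W[of i]] wasserstein_commute[OF p G a W[of "i - 1"]] by simp
    also have "\<dots> \<le> 1 / 2 * wasserstein p (m (i - 1)) (m (i + 1)) + wasserstein p (m (i - 1)) (m i)"
      by (intro add_right_mono wasserstein_mccann_le[where G=G, OF p o[of "i - 1" "i + 1"]]) simp
    also have "\<dots> \<le> 1 / 2 * (L * 2) + L"
      using lip[of "i - 1" "i + 1"] lip[of "i - 1" i] by simp
    finally show ?thesis using False by (simp add: subdivide_downsample_odd)
  qed
qed

theorem theorem5p2:
  fixes p :: real
    and G :: "(real ^ 'd) measure \<Rightarrow> (real ^ 'd) measure \<Rightarrow> ((real ^ 'd) \<times> (real ^ 'd)) measure"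
    and T :: "(real ^ 'd) measure \<Rightarrow> (real ^ 'd) measure \<Rightarrow> real ^ 'd \<Rightarrow> real ^ 'd"
    and c :: "real \<Rightarrow> (real ^ 'd) measure"
    and J :: nat
    and m :: "nat \<Rightarrow> int \<Rightarrow> (real ^ 'd) measure"
  assumes "1 \<le> p"
    and "optimal_plan_choice p G"
    and "abs_cont_curve p c"
    and "max_speed p c < \<infinity>"
    and "\<And>i. m J i = c (real_of_int i / 2 ^ J)"
    and "\<And>l. l \<in> {1..J} \<Longrightarrow> m (l - 1) = downsample (m l)"
  shows "(ac_setting p G T J m \<longrightarrow>
            (\<forall>l\<in>{1..J}. ac_detail_norm p G T m l \<le> max_speed p c * ennreal (2 powr (1 - real l)))) \<and>
         (discrete_setting J m \<longrightarrow>
            (\<forall>l\<in>{1..J}. discrete_detail_norm p G m l \<le> max_speed p c * ennreal (2 powr (1 - real l))))"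
proof -
  note p = assms(1) and G = assms(2)
  define \<Gamma> where "\<Gamma> = enn2real (max_speed p c)"
  have \<Gamma>: "max_speed p c = ennreal \<Gamma>" "0 \<le> \<Gamma>"
    using assms(4) by (auto simp: \<Gamma>_def)
  \<comment> \<open>Downward induction from level \<open>J\<close>: downsampling doubles the index,
    which cancels one factor 2 of the denominator.\<close>
  have samples: "m l i = c (real_of_int i / 2 ^ l)" if "l \<le> J" for l i
    using that
  proof (induction l arbitrary: i rule: inc_induct)
    case base
    show ?case by (rule assms(5))
  next
    case (step n)
    then have "m n = downsample (m (Suc n))" using assms(6)[of "Suc n"] by simp
    then show ?case using step.IH by (simp add: downsample_def)
  qed
  have *: "subdivide G (m (l - 1)) i \<in> wasserstein_space p"
    "m l i \<in> wasserstein_space p"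
    "ennreal (wasserstein p (subdivide G (m (l - 1)) i) (m l i)) \<le> max_speed p c * ennreal (2 powr (1 - real l))"
    if l: "l \<in> {1..J}" for l i
  proof -
    have W: "m l i \<in> wasserstein_space p" for i
      using assms(3) l samples[of l] by (simp add: abs_cont_curve_def)
    \<comment> \<open>Consecutive samples at level \<open>l\<close> are \<open>1 / 2 ^ l\<close>
      apart in time, which fixes the constant \<open>L = \<Gamma> / 2 ^ l\<close>; the prediction
      error bound \<open>2 * L\<close> is then
      \<open>\<Gamma> * 2 powr (1 - real l)\<close>.\<close>
    have lip: "wasserstein p (m l i) (m l j) \<le> \<Gamma> / 2 ^ l * of_int (j - i)" if "i \<le> j" for i j
      using abs_cont_curve_lipschitz[OF p G assms(3,4), of "of_int i / 2 ^ l" "of_int j / 2 ^ l"] that l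
      by (simp add: samples \<Gamma>_def divide_right_mono diff_divide_distrib[symmetric])
    note sub = subdivide_lipschitz_samples[OF p G W lip, folded assms(6)[OF l]]
    show "subdivide G (m (l - 1)) i \<in> wasserstein_space p" by (rule sub(1))
    show "m l i \<in> wasserstein_space p" by (rule W)
    have "2 * (\<Gamma> / 2 ^ l) = \<Gamma> * 2 powr (1 - real l)"
      by (simp add: powr_diff powr_realpow)
    then show "ennreal (wasserstein p (subdivide G (m (l - 1)) i) (m l i))
        \<le> max_speed p c * ennreal (2 powr (1 - real l))"
      using sub(2)[of i] \<Gamma>(2) unfolding \<Gamma>(1) by (simp add: ennreal_mult[symmetric] ennreal_leI)
  qed
  show ?thesis
  proof (intro conjI impI ballI)
    fix l assume ac: "ac_setting p G T J m" and l: "l \<in> {1..J}"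
    have "ac_size p (subdivide G (m (l - 1)) i) (ac_detail G T m l i)
        = wasserstein p (subdivide G (m (l - 1)) i) (m l i)" for i
      unfolding ac_detail_def using ac l
      by (intro ac_size_ac_minus[OF p G] *(1,2)[OF l]) (auto simp: ac_setting_def)
    then show "ac_detail_norm p G T m l \<le> max_speed p c * ennreal (2 powr (1 - real l))"
      unfolding ac_detail_norm_def using *(3)[OF l] by (intro SUP_least) simp
  next
    fix l assume "discrete_setting J m" and l: "l \<in> {1..J}"
    show "discrete_detail_norm p G m l \<le> max_speed p c * ennreal (2 powr (1 - real l))"
      unfolding discrete_detail_norm_def
    proof (rule SUP_least)
      fix i
      have "optimal_plan p (subdivide G (m (l - 1)) i) (m l i) (G (subdivide G (m (l - 1)) i) (m l i))"
        using G *(1,2)[OF l] by (simp add: optimal_plan_choice_def)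
      from discrete_size_discrete_minus_le[where G=G, OF p *(1,2)[OF l] this]
      show "ennreal (discrete_size p (atoms (subdivide G (m (l - 1)) i)) (atoms (m l i))
          (discrete_detail G m l i)) \<le> max_speed p c * ennreal (2 powr (1 - real l))"
        unfolding discrete_detail_def by (intro order_trans[OF ennreal_leI *(3)[OF l]])
    qed
  qed
qed

end
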